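(* Let $n,k\geq 2$. The non-homogeneous quadratic algebras $Q_n^{(k)}$ and $Q_n^{(\leq k)}$ (and hence, in particular, $Q_n:=Q_n^{(\le n)}$) are non-homogeneous Koszul.
   Context: All algebras are unital associative algebras over a fixed field $\Bbbk$. $\underline{n}=\{1,\dots,n\}$. $Q_n^{(k)}$ (the algebra of quasi-Plücker coordinates) is the algebra with generators $q_{ij}^I$, where $i,j\in\underline n$, $I\subset\underline{n}$, $|I|=k-1$, $i\notin I$, and relations: (i) $q_{ij}^I$ does not depend on the ordering of elements of $I$; (ii) $q_{ij}^I=0$ whenever $j\in I$; (iii) $q_{ii}^I=1$ and $q_{ij}^Iq_{jl}^I=q_{il}^I$ for $i,j\notin I$; (iv) $q_{ij}^{N\setminus\{i,j\}}q_{jm}^{N\setminus\{j,m\}}=-q_{im}^{N\setminus\{i,m\}}$ for $N\subset\underline n$, $|N|=k+1$, and distinct $i,j,m\in N$; (v) $\sum_{j\in L}q_{ij}^Mq_{ji}^{L\setminus\{j\}}=1$ for $|L|=k$, $|M|=k-1$, $i\notin M$. As a non-homogeneous quadratic algebra, $Q_n^{(k)}$ is considered with the same generators and the presentation given by (i), (ii), (iii) and (v') $\displaystyle\sum_{j\in L\setminus\{i,l\}} q_{ij}^Mq_{jl}^{L\setminus\{j,l\}}+q_{il}^{L\setminus\{i,l\}}=q_{il}^M$ for all $L\subset\underline n$ with $|L|=k+1$, distinct $i,l\in L$, and $M\subset\underline n$ with $|M|=k-1$, $i\notin M$. Using (i), (ii) and $q_{ii}^I=1$, the space of generators $V$ has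 as a basis the $q_{ij}^I$ with $i\neq j$ and $i,j\notin I$. $Q_n^{(\leq k)}$ is the quotient of the coproduct (free product) of the algebras $Q_n^{(k')}$, $2\leq k'\leq k$, by the additional relations $q_{ij}^J=q_{ij}^{J\cup\{m\}}+q_{im}^J\,q_{mj}^{J\cup\{i\}}$ for $i\ne m$, $i,m\notin J$, $1\leq |J|\le k-2$. For $k'\geq n$ there are no generators in $V$ with $|I|=k'-1$, so such $k'$ contribute nothing. For a non-homogeneous quadratic algebra $A$ presented with generating space $V$ and relations in $\Bbbk\oplus V\oplus V^{\otimes 2}$, $A^{(0)}$ denotes the quadratic algebra obtained by replacing the relations by their homogeneous quadratic parts. $A$ is called non-homogeneous Koszul if the quadratic algebra $A^{(0)}$ is Koszul. *)

theory Defs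
  imports "HOL-Library.Poly_Mapping" "HOL-Algebra.QuotRing"
begin

section \<open>Free algebras\<close>

text \<open>
  Words over \<open>'g\<close> form a monoid under concatenation, written additively so that
  \<^typ>\<open>'g list \<Rightarrow>\<^sub>0 'k\<close>, with the convolution product of \<^theory>\<open>HOL-Library.Poly_Mapping\<close>,
  is the monoid algebra of the free monoid, that is, the tensor algebra \<open>T(V)\<close> of the vector
  space \<open>V\<close> with basis \<open>'g\<close>. A word of length \<open>d\<close> is a basis vector of the \<open>d\<close>-fold tensor
  power of \<open>V\<close>.
\<close>

instantiation list :: (type) monoid_add
begin

definition zero_list :: "'a list" where "zero_list = []"
definition plus_list :: "'a list \<Rightarrow> 'a list \<Rightarrow> 'a list" where "plus_list = (@)"

instance by standard (simp_all add: zero_list_def plus_list_def)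

end

type_synonym ('g, 'k) free_alg = "'g list \<Rightarrow>\<^sub>0 'k"

definition gen :: "'g \<Rightarrow> ('g, 'k::field) free_alg" where
  "gen x = Poly_Mapping.single [x] 1"

definition free_algebra :: "'g set \<Rightarrow> ('g, 'k::field) free_alg ring" where
  "free_algebra X =
    \<lparr>carrier = {f. Poly_Mapping.keys f \<subseteq> lists X}, mult = (*), one = 1, zero = 0, add = (+)\<rparr>"

definition hom_part :: "nat \<Rightarrow> ('g, 'k::field) free_alg \<Rightarrow> ('g, 'k) free_alg" where
  "hom_part d f =
    (\<Sum>w\<in>{w \<in> Poly_Mapping.keys f. length w = d}. Poly_Mapping.single w (Poly_Mapping.lookup f w))"

section \<open>Presented algebras and their grading\<close>

text \<open>
  The two-sided ideal generated by \<open>R\<close> is automatically a linear subspace, because the scalars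
  are elements of the unital ring \<open>free_algebra X\<close>.
\<close>

definition rel_ideal :: "'g set \<Rightarrow> ('g, 'k::field) free_alg set \<Rightarrow> ('g, 'k) free_alg set" where
  "rel_ideal X R = Idl\<^bsub>free_algebra X\<^esub> R"

definition presented_algebra ::
    "'g set \<Rightarrow> ('g, 'k::field) free_alg set \<Rightarrow> ('g, 'k) free_alg set ring" where
  "presented_algebra X R = free_algebra X Quot rel_ideal X R"

definition quot_class ::
    "'g set \<Rightarrow> ('g, 'k::field) free_alg set \<Rightarrow> ('g, 'k) free_alg \<Rightarrow> ('g, 'k) free_alg set" where
  "quot_class X R f = rel_ideal X R +>\<^bsub>free_algebra X\<^esub> f"

definition graded_component ::
    "'g set \<Rightarrow> ('g, 'k::field) free_alg set \<Rightarrow> nat \<Rightarrow> ('g, 'k) free_alg set set" where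
  "graded_component X R d =
    quot_class X R ` {f \<in> carrier (free_algebra X). \<forall>w\<in>Poly_Mapping.keys f. length w = d}"

definition augmentation_ideal ::
    "'g set \<Rightarrow> ('g, 'k::field) free_alg set \<Rightarrow> ('g, 'k) free_alg set set" where
  "augmentation_ideal X R =
    quot_class X R ` {f \<in> carrier (free_algebra X). \<forall>w\<in>Poly_Mapping.keys f. length w > 0}"

section \<open>Linear free resolutions and Koszul algebras\<close>

text \<open>The free left \<open>A\<close>-module on a set \<open>B\<close>, as finitely supported functions.\<close>

definition free_module :: "('a, 'm) ring_scheme \<Rightarrow> 'b set \<Rightarrow> ('b \<Rightarrow> 'a) set" where
  "free_module A B =
    {f. (\<forall>b\<in>B. f b \<in> carrier A) \<and> (\<forall>b. b \<notin> B \<longrightarrow> f b = \<zero>\<^bsub>A\<^esub>) \<and> finite {b. f b \<noteq> \<zero>\<^bsub>A\<^esub>}}"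

text \<open>The left \<open>A\<close>-linear map from the free module on \<open>B\<close> that sends each \<open>b \<in> B\<close> to \<open>D b\<close>.\<close>

definition free_map ::
    "('a, 'm) ring_scheme \<Rightarrow> 'b set \<Rightarrow> ('b \<Rightarrow> 'c \<Rightarrow> 'a) \<Rightarrow> ('b \<Rightarrow> 'a) \<Rightarrow> 'c \<Rightarrow> 'a" where
  "free_map A B D f = (\<lambda>c. \<Oplus>\<^bsub>A\<^esub>b\<in>{b \<in> B. f b \<noteq> \<zero>\<^bsub>A\<^esub>}. f b \<otimes>\<^bsub>A\<^esub> D b c)"

text \<open>
  Let \<open>A\<close> be a connected graded algebra with components \<open>G d\<close>, and let \<open>Aplus\<close> be the kernel of
  its augmentation onto the ground field. The data \<open>B, D\<close> describe a complex of free left modules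
  \[ \cdots \to P_2 \to P_1 \to P_0 = A \to A/Aplus \to 0, \]
  where \<open>P_i\<close> is free on \<open>B i\<close> and \<open>D i\<close> is the matrix of the map from \<open>P_{i+1}\<close> to \<open>P_i\<close>.
  Placing the basis \<open>B i\<close> in internal degree \<open>i\<close>, the maps preserve degree
  exactly when all matrix entries have degree 1. So the predicate below says that this is
  a graded free resolution of the trivial module with \<open>P_i\<close> generated in degree \<open>i\<close>.
\<close>

definition linear_free_resolution ::
    "('a, 'm) ring_scheme \<Rightarrow> (nat \<Rightarrow> 'a set) \<Rightarrow> 'a set \<Rightarrow>
     (nat \<Rightarrow> 'b set) \<Rightarrow> (nat \<Rightarrow> 'b \<Rightarrow> 'b \<Rightarrow> 'a) \<Rightarrow> bool" where
  "linear_free_resolution A G Aplus B D \<longleftrightarrow>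
    (\<forall>i. \<forall>b\<in>B (Suc i). D i b \<in> free_module A (B i) \<and> (\<forall>c\<in>B i. D i b c \<in> G 1)) \<and>
    (\<exists>b0. B 0 = {b0} \<and>
      free_map A (B 1) (D 0) ` free_module A (B 1) = {f \<in> free_module A (B 0). f b0 \<in> Aplus}) \<and>
    (\<forall>i. free_map A (B (Suc (Suc i))) (D (Suc i)) ` free_module A (B (Suc (Suc i)))
       = {f \<in> free_module A (B (Suc i)). free_map A (B (Suc i)) (D i) f = (\<lambda>_. \<zero>\<^bsub>A\<^esub>)})"

text \<open>
  Koszulness of a quadratic algebra \<open>A = T(V)/(R)\<close>, where \<open>X\<close> is a basis of \<open>V\<close> and
  \<open>R\<close> consists of homogeneous elements of degree 2: the trivial module has a linear free
  resolution; equivalently, \<open>Ext\<^sub>A(A/Aplus, A/Aplus)\<close> is concentrated on the diagonal. In such a resolution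
  the dimension of \<open>A/Aplus \<otimes>\<^sub>A P_i\<close> is the dimension of a subspace of the \<open>i\<close>-fold
  tensor power of \<open>V\<close>, so indexing the bases by words in the generators is no restriction.
\<close>

definition koszul :: "'g set \<Rightarrow> ('g, 'k::field) free_alg set \<Rightarrow> bool" where
  "koszul X R \<longleftrightarrow>
    (\<exists>(B :: nat \<Rightarrow> 'g list set) D.
      linear_free_resolution (presented_algebra X R) (graded_component X R)
        (augmentation_ideal X R) B D)"

section \<open>Non-homogeneous quadratic algebras\<close>

definition nonhomogeneous_quadratic :: "'g set \<Rightarrow> ('g, 'k::field) free_alg set \<Rightarrow> bool" where
  "nonhomogeneous_quadratic X R \<longleftrightarrow>
    R \<subseteq> {f \<in> carrier (free_algebra X). \<forall>w\<in>Poly_Mapping.keys f. length w \<le> 2}"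

text \<open>
  Taking quadratic parts is linear, so it makes no difference for the ideal generated whether it is
  applied to \<open>R\<close> or to the linear span of \<open>R\<close>.
\<close>

definition nonhomogeneous_koszul :: "'g set \<Rightarrow> ('g, 'k::field) free_alg set \<Rightarrow> bool" where
  "nonhomogeneous_koszul X R \<longleftrightarrow>
    nonhomogeneous_quadratic X R \<and> koszul X (hom_part 2 ` R)"

section \<open>Quasi-Pluecker coordinates\<close>

text \<open>The triple \<open>(i, j, I)\<close> stands for the generator with lower indices \<open>i j\<close> and upper index \<open>I\<close>.\<close>

type_synonym qgen = "nat \<times> nat \<times> nat set"

definition Q_gens :: "nat \<Rightarrow> nat \<Rightarrow> qgen set" where
  "Q_gens n k = {(i, j, I). i \<in> {1..n} \<and> j \<in> {1..n} \<and> I \<subseteq> {1..n} \<and> card I = k - 1 \<and>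
                            i \<noteq> j \<and> i \<notin> I \<and> j \<notin> I}"

text \<open>
  The elements with \<open>i = j\<close> or \<open>j \<in> I\<close> are not generators of the quadratic presentation: they
  are \<open>1\<close> and \<open>0\<close>, respectively. Used only for \<open>i \<notin> I\<close>, so the two cases do not overlap.
\<close>

definition qp :: "nat \<Rightarrow> nat \<Rightarrow> nat set \<Rightarrow> (qgen, 'k::field) free_alg" where
  "qp i j I = (if j \<in> I then 0 else if i = j then 1 else gen (i, j, I))"

definition Q_rels :: "nat \<Rightarrow> nat \<Rightarrow> (qgen, 'k::field) free_alg set" where
  "Q_rels n k =
    {qp i j I * qp j l I - qp i l I | i j l I.
       i \<in> {1..n} \<and> j \<in> {1..n} \<and> l \<in> {1..n} \<and> I \<subseteq> {1..n} \<and> card I = k - 1 \<and>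
       i \<notin> I \<and> j \<notin> I} \<union>
    {(\<Sum>j\<in>L - {i, l}. qp i j M * qp j l (L - {j, l})) + qp i l (L - {i, l}) - qp i l M | i l L M.
       L \<subseteq> {1..n} \<and> card L = k + 1 \<and> i \<in> L \<and> l \<in> L \<and> i \<noteq> l \<and>
       M \<subseteq> {1..n} \<and> card M = k - 1 \<and> i \<notin> M}"

text \<open>
  The coproduct of presented algebras is presented by the disjoint union of the generators and
  the union of the relations; the generator sets for different \<open>k'\<close> are disjoint because
  \<open>card I = k' - 1\<close>.
\<close>

definition Q_le_gens :: "nat \<Rightarrow> nat \<Rightarrow> qgen set" where
  "Q_le_gens n k = (\<Union>k'\<in>{2..k}. Q_gens n k')"

definition Q_le_rels :: "nat \<Rightarrow> nat \<Rightarrow> (qgen, 'k::field) free_alg set" where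
  "Q_le_rels n k =
    (\<Union>k'\<in>{2..k}. Q_rels n k') \<union>
    {qp i j J - (qp i j (J \<union> {m}) + qp i m J * qp m j (J \<union> {i})) | i j m J.
       i \<in> {1..n} \<and> j \<in> {1..n} \<and> m \<in> {1..n} \<and> J \<subseteq> {1..n} \<and>
       i \<noteq> m \<and> i \<notin> J \<and> m \<notin> J \<and> 1 \<le> card J \<and> card J \<le> k - 2}"

end

theory Submission
  imports Defs
begin

text \<open>
  Attach to a generator \<open>(i, j, I)\<close> the set \<open>U = I \<union> {i}\<close>, so that it becomes the entry \<open>x\<^sup>U\<^sub>i\<^sub>j\<close>
  with \<open>i \<in> U\<close> and \<open>j \<notin> U\<close>. The quadratic parts of all relations then have the uniform shape
  \<open>\<Sum>j\<in>S - U. x\<^sup>U\<^sub>a\<^sub>j x\<^sup>S\<^sub>j\<^sub>l = 0\<close>, for certain pairs \<open>U, S\<close>, all \<open>l \<notin> S\<close>, and all \<open>a\<close> in a set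
  \<open>A U S \<subseteq> U\<close> of rows. Split a tensor product of generators with sets \<open>U\<^sub>0, U\<^sub>1, \<dots>\<close> between the row and
  the column index of each letter: a relation at two neighbouring letters fixes a line in one factor
  and restricts the factor to its left to rows in \<open>A U S\<close>. So each factor carries at most two
  subspaces, the relations generate a distributive lattice, and the Koszul complex is exact.

  Concretely, the Koszul complex has as a basis the elements
  \<open>w(a; U\<^sub>0, \<dots>, U\<^sub>d; b) = \<Sum> x\<^sub>a\<^sub>j x\<^sub>j\<^sub>k \<cdots> x\<^sub>m\<^sub>b\<close> such that the contraction between \<open>U\<^sub>p\<close> and \<open>U\<^sub>p\<^sub>+\<^sub>1\<close>
  runs over rows allowed for the next one, with differential
  \<open>w(a; U\<^sub>0, U\<^sub>1, \<dots>; b) \<mapsto> \<Sum>j. x\<^sub>a\<^sub>j w(j; U\<^sub>1, \<dots>; b)\<close>. Exactness reduces to exactness of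
  \<open>A \<otimes> R \<rightarrow> A \<otimes> V \<rightarrow> A\<close>, which holds for every quadratic algebra.
\<close>

section \<open>Free algebras\<close>

abbreviation lookup where "lookup \<equiv> Poly_Mapping.lookup"
abbreviation keys where "keys \<equiv> Poly_Mapping.keys"
abbreviation single where "single \<equiv> Poly_Mapping.single"
abbreviation falg :: "'g set \<Rightarrow> ('g, 'k::field) free_alg set" where
  "falg X \<equiv> carrier (free_algebra X)"

lemma poly_mapping_eq_sum_single: "f = (\<Sum>w\<in>keys f. single w (lookup f w))"
  by (rule poly_mapping_eqI) (auto simp: lookup_sum lookup_single when_def sum.delta in_keys_iff)

lemma free_alg_induct [case_names single add]:
  fixes f :: "('g, 'k::field) free_alg"
  assumes "\<And>w c. P (single w c)" and add: "\<And>f g. P f \<Longrightarrow> P g \<Longrightarrow> P (f + g)"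
  shows "P f"
proof -
  have "P (\<Sum>w\<in>W. single w (lookup f w))" if "finite W" for W
    using that
  proof (induction W)
    case empty
    show ?case using assms(1)[of undefined 0] by simp
  qed (simp add: assms)
  then show ?thesis
    by (subst poly_mapping_eq_sum_single) simp
qed

lemma falg_iff: "f \<in> falg X \<longleftrightarrow> keys f \<subseteq> lists X"
  by (simp add: free_algebra_def)

lemma falg_0 [simp]: "0 \<in> falg X"
  by (simp add: falg_iff)

lemma falg_add [intro]: "f \<in> falg X \<Longrightarrow> g \<in> falg X \<Longrightarrow> f + g \<in> falg X"
  unfolding falg_iff using keys_add[of f g] by blast

lemma falg_uminus [intro]:
  fixes f :: "('g, 'k::field) free_alg"
  shows "f \<in> falg X \<Longrightarrow> - f \<in> falg X"
  by (auto simp: falg_iff in_keys_iff)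

lemma falg_single [intro]: "w \<in> lists X \<Longrightarrow> single w c \<in> falg X"
  by (simp add: falg_iff)

lemma falg_1 [simp]: "1 \<in> falg X"
  by (simp add: falg_iff zero_list_def)

lemma falg_mult [intro]: "f \<in> falg X \<Longrightarrow> g \<in> falg X \<Longrightarrow> f * g \<in> falg X"
  unfolding falg_iff using keys_mult[of f g] by (fastforce simp: plus_list_def)

lemma falg_sum [intro]:
  fixes F :: "'i \<Rightarrow> ('g, 'k::field) free_alg"
  shows "(\<And>i. i \<in> S \<Longrightarrow> F i \<in> falg X) \<Longrightarrow> sum F S \<in> falg X"
  by (induction S rule: infinite_finite_induct) (auto intro: falg_add)

lemma falg_gen [intro]: "g \<in> X \<Longrightarrow> gen g \<in> falg X"
  by (auto simp: gen_def)

section \<open>Splitting off the last letter of a word\<close>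

lemma lookup_mult_gen:
  "lookup (f * gen g) w = (if w \<noteq> [] \<and> last w = g then lookup f (butlast w) else 0)"
proof (induction f rule: free_alg_induct)
  case (single v c)
  have "w = v @ [g] \<longleftrightarrow> w \<noteq> [] \<and> last w = g \<and> butlast w = v"
    by (metis append_butlast_last_id append_is_Nil_conv butlast_snoc last_snoc not_Cons_self2)
  then show ?case
    by (auto simp: gen_def mult_single lookup_single when_def plus_list_def)
next
  case (add f h)
  then show ?case
    by (simp add: distrib_right lookup_add)
qed

text \<open>The coefficient of \<open>g\<close> when the free algebra is viewed as the scalars plus
  the free left module on the generators: every nonempty word has exactly one last letter.
  \<open>falg_decomp\<close> is this decomposition.\<close>

definition right_part :: "'g \<Rightarrow> ('g, 'k::field) free_alg \<Rightarrow> ('g, 'k) free_alg" where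
  "right_part g f = Poly_Mapping.map_key (\<lambda>w. w @ [g]) f"

lemma lookup_right_part: "lookup (right_part g f) w = lookup f (w @ [g])"
  by (simp add: right_part_def map_key.rep_eq inj_def)

lemma right_part_0 [simp]: "right_part g 0 = 0"
  by (rule poly_mapping_eqI) (simp add: lookup_right_part)

lemma right_part_add: "right_part g (f + h) = right_part g f + right_part g h"
  by (rule poly_mapping_eqI) (simp add: lookup_right_part lookup_add)

lemma right_part_sum: "right_part g (sum F S) = (\<Sum>i\<in>S. right_part g (F i))"
  by (rule poly_mapping_eqI) (simp add: lookup_right_part lookup_sum)

lemma right_part_mult_gen: "right_part h (f * gen g) = (if g = h then f else 0)"
  by (rule poly_mapping_eqI) (auto simp: lookup_right_part lookup_mult_gen)

lemma right_part_closed [intro]: "f \<in> falg X \<Longrightarrow> right_part g f \<in> falg X"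
  unfolding falg_iff subset_iff in_keys_iff lookup_right_part
  by (metis append_in_lists_conv)

lemma falg_decomp:
  fixes f :: "('g, 'k::field) free_alg"
  assumes "finite X" and "f \<in> falg X"
  shows "f = single [] (lookup f []) + (\<Sum>g\<in>X. right_part g f * gen g)"
proof (rule poly_mapping_eqI)
  fix w
  have "lookup (\<Sum>g\<in>X. right_part g f * gen g) w =
      (\<Sum>g\<in>X. if w \<noteq> [] \<and> last w = g then lookup f w else 0)"
    unfolding lookup_sum
    by (intro sum.cong refl) (auto simp: lookup_mult_gen lookup_right_part)
  also have "\<dots> = (if w \<noteq> [] then lookup f w else 0)"
  proof (cases "w \<noteq> [] \<and> lookup f w \<noteq> 0")
    case True
    then have "w \<in> lists X"
      using assms(2) by (auto simp: falg_iff in_keys_iff)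
    then have "last w \<in> X"
      using True by auto
    then show ?thesis
      using True assms(1) by simp
  qed (auto intro!: sum.neutral)
  finally show "lookup f w = lookup (single [] (lookup f []) + (\<Sum>g\<in>X. right_part g f * gen g)) w"
    by (simp add: lookup_add lookup_single when_def)
qed

lemma keys_mult_gen_length:
  "w \<in> keys (f * gen g) \<Longrightarrow> length w > 0"
  by (auto simp: in_keys_iff lookup_mult_gen split: if_splits)

section \<open>Ring structure and ideals of the free algebra\<close>

lemma ring_free_algebra: "ring (free_algebra X :: ('g, 'k::field) free_alg ring)"
proof (rule ringI)
  show "abelian_group (free_algebra X :: ('g, 'k) free_alg ring)"
  proof (rule abelian_groupI)
    fix x :: "('g, 'k) free_alg"
    assume "x \<in> falg X"
    then show "\<exists>y\<in>falg X. y \<oplus>\<^bsub>free_algebra X\<^esub> x = \<zero>\<^bsub>free_algebra X\<^esub>"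
      by (intro bexI[of _ "- x"] falg_uminus) (simp_all add: free_algebra_def)
  qed (auto simp: free_algebra_def[of X, THEN arg_cong[of _ _ "ring.add"]]
      free_algebra_def[of X, THEN arg_cong[of _ _ "ring.zero"]] add.assoc add.commute)
  show "monoid (free_algebra X :: ('g, 'k) free_alg ring)"
    by (rule monoidI) (auto simp: free_algebra_def[of X, THEN arg_cong[of _ _ "monoid.mult"]]
      free_algebra_def[of X, THEN arg_cong[of _ _ "monoid.one"]] mult.assoc)
qed (simp_all add: free_algebra_def distrib_left distrib_right)

lemma free_algebra_simps [simp]:
  "f \<oplus>\<^bsub>free_algebra X\<^esub> g = f + g" "f \<otimes>\<^bsub>free_algebra X\<^esub> g = f * g"
  "\<zero>\<^bsub>free_algebra X\<^esub> = 0" "\<one>\<^bsub>free_algebra X\<^esub> = 1"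
  by (simp_all add: free_algebra_def)

lemma a_inv_free_algebra:
  fixes f :: "('g, 'k::field) free_alg"
  assumes "f \<in> falg X"
  shows "\<ominus>\<^bsub>free_algebra X\<^esub> f = - f"
proof -
  interpret ring "free_algebra X :: ('g, 'k) free_alg ring"
    by (rule ring_free_algebra)
  show ?thesis
    by (rule minus_equality) (use assms in auto)
qed

lemma ideal_free_algebraI:
  fixes J :: "('g, 'k::field) free_alg set"
  assumes "J \<subseteq> falg X" "0 \<in> J" "\<And>f g. f \<in> J \<Longrightarrow> g \<in> J \<Longrightarrow> f + g \<in> J"
    and "\<And>f t. f \<in> J \<Longrightarrow> t \<in> falg X \<Longrightarrow> t * f \<in> J"
    and "\<And>f t. f \<in> J \<Longrightarrow> t \<in> falg X \<Longrightarrow> f * t \<in> J"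
  shows "ideal J (free_algebra X)"
proof (rule idealI)
  interpret ring "free_algebra X :: ('g, 'k) free_alg ring"
    by (rule ring_free_algebra)
  show "ring (free_algebra X :: ('g, 'k) free_alg ring)"
    by (rule ring_free_algebra)
  have neg: "- f \<in> J" if "f \<in> J" for f
    using assms(4)[OF that falg_uminus[OF falg_1]] by simp
  show "subgroup J (add_monoid (free_algebra X))"
  proof (rule add.subgroupI)
    fix f assume "f \<in> J"
    then show "\<ominus>\<^bsub>free_algebra X\<^esub> f \<in> J"
      using assms(1) neg a_inv_free_algebra by (metis subsetD)
  qed (use assms in auto)
qed (use assms in auto)

section \<open>Presented algebras\<close>

locale presentation =
  fixes X :: "'g set" and R :: "('g, 'k::field) free_alg set"
  assumes finite_gens: "finite X" and rels_closed: "R \<subseteq> falg X"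
begin

definition I where "I = rel_ideal X R"

definition cls where "cls = quot_class X R"

lemma ideal_I: "ideal I (free_algebra X)"
  unfolding I_def rel_ideal_def
  by (rule ring.genideal_ideal[OF ring_free_algebra rels_closed])

sublocale T: ideal I "free_algebra X :: ('g, 'k) free_alg ring"
  by (rule ideal_I)

lemma I_rel: "r \<in> R \<Longrightarrow> r \<in> I"
  using ring.genideal_self[OF ring_free_algebra rels_closed] unfolding I_def rel_ideal_def by blast

lemma I_closed: "f \<in> I \<Longrightarrow> f \<in> falg X"
  using T.a_Hcarr by simp

lemma I_0 [simp]: "0 \<in> I"
  using additive_subgroup.zero_closed[OF T.is_additive_subgroup] by simp

lemma I_add: "f \<in> I \<Longrightarrow> g \<in> I \<Longrightarrow> f + g \<in> I"
  using additive_subgroup.a_closed[OF T.is_additive_subgroup] by simp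

lemma I_mult_left: "f \<in> I \<Longrightarrow> t \<in> falg X \<Longrightarrow> t * f \<in> I"
  using T.I_l_closed by simp

lemma I_mult_right: "f \<in> I \<Longrightarrow> t \<in> falg X \<Longrightarrow> f * t \<in> I"
  using T.I_r_closed by simp

lemma I_uminus: "f \<in> I \<Longrightarrow> - f \<in> I"
  using I_mult_left[of f "- 1", OF _ falg_uminus[OF falg_1]] by simp

lemma I_diff: "f \<in> I \<Longrightarrow> g \<in> I \<Longrightarrow> f - g \<in> I"
  using I_add[of f "- g"] I_uminus by simp

lemma I_sum: "(\<And>i. i \<in> S \<Longrightarrow> F i \<in> I) \<Longrightarrow> sum F S \<in> I"
  by (induction S rule: infinite_finite_induct) (auto intro: I_add)

lemma I_trans: "f - g \<in> I \<Longrightarrow> g - h \<in> I \<Longrightarrow> f - h \<in> I"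
  using I_add[of "f - g" "g - h"] by simp

lemma I_cong: "f - g \<in> I \<Longrightarrow> f \<in> I \<longleftrightarrow> g \<in> I"
  using I_add[of "f - g" g] I_diff[of f "f - g"] by auto

lemma I_minimal: "ideal J (free_algebra X) \<Longrightarrow> R \<subseteq> J \<Longrightarrow> I \<subseteq> J"
  unfolding I_def rel_ideal_def using ring.genideal_minimal[OF ring_free_algebra] by blast

lemma cls_alt: "cls f = I +>\<^bsub>free_algebra X\<^esub> f"
  by (simp add: cls_def quot_class_def I_def)

lemma cls_eq_iff:
  assumes "f \<in> falg X" and "g \<in> falg X"
  shows "cls f = cls g \<longleftrightarrow> f - g \<in> I"
  unfolding cls_alt T.quotient_eq_iff_same_a_r_cos[OF ideal_I assms, symmetric]
  using assms by (simp add: a_minus_def a_inv_free_algebra)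

lemma presented_algebra_simps:
  "carrier (presented_algebra X R) = cls ` falg X"
  "\<zero>\<^bsub>presented_algebra X R\<^esub> = cls 0"
  "f \<in> falg X \<Longrightarrow> g \<in> falg X \<Longrightarrow> cls f \<otimes>\<^bsub>presented_algebra X R\<^esub> cls g = cls (f * g)"
  "f \<in> falg X \<Longrightarrow> g \<in> falg X \<Longrightarrow> cls f \<oplus>\<^bsub>presented_algebra X R\<^esub> cls g = cls (f + g)"
proof -
  have P: "presented_algebra X R = free_algebra X Quot I"
    by (simp add: presented_algebra_def I_def)
  show "carrier (presented_algebra X R) = cls ` falg X"
    unfolding P by (auto simp: FactRing_def A_RCOSETS_def' cls_alt)
  have "I +>\<^bsub>free_algebra X\<^esub> 0 = I"
    using T.a_coset_join2[of 0 I] T.a_subgroup by simp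
  then show "\<zero>\<^bsub>presented_algebra X R\<^esub> = cls 0"
    unfolding P by (simp add: FactRing_def cls_alt)
  show "cls f \<otimes>\<^bsub>presented_algebra X R\<^esub> cls g = cls (f * g)"
    if "f \<in> falg X" "g \<in> falg X"
    unfolding P using T.rcoset_mult_add[OF that] by (simp add: FactRing_def cls_alt)
  show "cls f \<oplus>\<^bsub>presented_algebra X R\<^esub> cls g = cls (f + g)"
    if "f \<in> falg X" "g \<in> falg X"
    unfolding P using T.a_rcos_sum[OF that] by (simp add: FactRing_def cls_alt)
qed

lemma ring_presented_algebra: "ring (presented_algebra X R)"
  unfolding presented_algebra_def I_def[symmetric] by (rule T.quotient_is_ring)

lemma finsum_cls:
  assumes "\<And>i. i \<in> S \<Longrightarrow> F i \<in> falg X"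
  shows "(\<Oplus>\<^bsub>presented_algebra X R\<^esub>i\<in>S. cls (F i)) = cls (sum F S)"
proof -
  interpret P: ring "presented_algebra X R"
    by (rule ring_presented_algebra)
  show ?thesis
    using assms
  proof (induction S rule: infinite_finite_induct)
    \<comment> \<open>On an infinite index set both \<open>finsum\<close> and \<open>sum\<close>
      return zero by default.\<close>
    case (infinite S)
    then show ?case
      by (simp add: finsum_def finprod_def presented_algebra_simps)
  next
    case empty
    show ?case
      by (simp add: presented_algebra_simps)
  next
    case (insert x S)
    then show ?case
      by (simp add: P.finsum_insert presented_algebra_simps falg_sum)
  qed
qed

text \<open>Lifting elements of a free module to families in the free algebra turns questions about
  the resolution into questions modulo \<open>I\<close>. Finiteness of \<open>B\<close> supplies the
  finite support.\<close>

lemma free_module_cls: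
  assumes "finite B"
  shows "free_module (presented_algebra X R) B =
    {(\<lambda>b. if b \<in> B then cls (F b) else cls 0) | F. \<forall>b. F b \<in> falg X}"
proof (intro subset_antisym subsetI)
  fix f assume f: "f \<in> free_module (presented_algebra X R) B"
  then have "\<forall>b. \<exists>t. t \<in> falg X \<and> (b \<in> B \<longrightarrow> f b = cls t)"
    unfolding free_module_def by (auto simp: presented_algebra_simps) (metis falg_0 imageE)
  then obtain F where "\<forall>b. F b \<in> falg X \<and> (b \<in> B \<longrightarrow> f b = cls (F b))"
    by metis
  moreover have "f b = cls 0" if "b \<notin> B" for b
    using f that by (auto simp: free_module_def presented_algebra_simps)
  ultimately show "f \<in> {(\<lambda>b. if b \<in> B then cls (F b) else cls 0) | F. \<forall>b. F b \<in> falg X}"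
    by (intro CollectI exI[of _ F]) (auto simp: fun_eq_iff)
next
  fix f assume "f \<in> {(\<lambda>b. if b \<in> B then cls (F b) else cls 0) | F. \<forall>b. F b \<in> falg X}"
  then show "f \<in> free_module (presented_algebra X R) B"
    using assms by (auto simp: free_module_def presented_algebra_simps)
qed

lemma free_map_cls:
  assumes "finite B" "\<And>b. F b \<in> falg X" "\<And>b. b \<in> B \<Longrightarrow> d b c \<in> falg X"
  shows "free_map (presented_algebra X R) B (\<lambda>b c. cls (d b c))
      (\<lambda>b. if b \<in> B then cls (F b) else cls 0) c = cls (\<Sum>b\<in>B. F b * d b c)"
proof -
  let ?f = "\<lambda>b. if b \<in> B then cls (F b) else cls 0"
  let ?S = "{b \<in> B. cls (F b) \<noteq> cls 0}"
  interpret P: ring "presented_algebra X R"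
    by (rule ring_presented_algebra)
  have "free_map (presented_algebra X R) B (\<lambda>b c. cls (d b c)) ?f c =
      (\<Oplus>\<^bsub>presented_algebra X R\<^esub>b\<in>?S. ?f b \<otimes>\<^bsub>presented_algebra X R\<^esub> cls (d b c))"
    unfolding free_map_def presented_algebra_simps
    by (rule arg_cong[where f = "finsum (presented_algebra X R) _"]) auto
  also have "\<dots> = (\<Oplus>\<^bsub>presented_algebra X R\<^esub>b\<in>?S. cls (F b * d b c))"
    by (rule P.finsum_cong') (use assms in \<open>auto simp: presented_algebra_simps\<close>)
  also have "\<dots> = cls (\<Sum>b\<in>?S. F b * d b c)"
    by (rule finsum_cls) (use assms in auto)
  \<comment> \<open>\<open>free_map\<close> skips the \<open>b\<close> whose coefficient is zero in
    the quotient. The skipped terms lie in \<open>I\<close> because \<open>F b\<close> does.\<close>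
  also have "\<dots> = cls (\<Sum>b\<in>B. F b * d b c)"
  proof -
    have "(\<Sum>b\<in>B. F b * d b c) - (\<Sum>b\<in>?S. F b * d b c) = (\<Sum>b\<in>B - ?S. F b * d b c)"
      using sum.subset_diff[of ?S B "\<lambda>b. F b * d b c"] assms(1) by simp
    also have "\<dots> \<in> I"
    proof (rule I_sum)
      fix b assume b: "b \<in> B - ?S"
      then have "F b \<in> I"
        using cls_eq_iff[of "F b" 0] assms(2) by auto
      then show "F b * d b c \<in> I"
        using b assms(3) by (auto intro: I_mult_right)
    qed
    finally show ?thesis
      using assms by (subst cls_eq_iff) (auto intro!: falg_sum dest: I_uminus)
  qed
  finally show ?thesis .
qed

end

text \<open>Equality of two sets of relations up to sign and up to the zero relation is
  \<open>signed R = signed R'\<close>.\<close>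

definition signed :: "'a::ring_1 set \<Rightarrow> 'a set" where
  "signed S = insert 0 (S \<union> uminus ` S)"

section \<open>A criterion for Koszulness\<close>

context presentation
begin

text \<open>The resolution is described by a matrix over the free algebra, and composites and cycles
  are tested only modulo \<open>I\<close>. \<open>cplx\<close> and \<open>exact\<close> give the two
  inclusions of exactness, \<open>aug_sound\<close> and \<open>aug_complete\<close> those at the
  augmentation. Vanishing off \<open>B d\<close> is what makes a row of the matrix an element of the
  free module on \<open>B d\<close>.\<close>

lemma koszulI:
  fixes B :: "nat \<Rightarrow> 'g list set" and boundary :: "'g list \<Rightarrow> 'g list \<Rightarrow> ('g, 'k) free_alg"
  assumes B0: "B 0 = {[]}" and fin: "\<And>d. finite (B d)"
    and boundary: "\<And>d w v. w \<in> B (Suc d) \<Longrightarrow> v \<in> B d \<Longrightarrow> boundary w v \<in> falg X"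
    and boundary_degree: "\<And>d w v u. w \<in> B (Suc d) \<Longrightarrow> v \<in> B d \<Longrightarrow> u \<in> keys (boundary w v) \<Longrightarrow> length u = 1"
    and boundary_zero: "\<And>d w v. w \<in> B (Suc d) \<Longrightarrow> v \<notin> B d \<Longrightarrow> boundary w v = 0"
    and aug_sound: "\<And>F u. \<forall>w. F w \<in> falg X \<Longrightarrow> u \<in> keys (\<Sum>w\<in>B 1. F w * boundary w []) \<Longrightarrow> length u > 0"
    and aug_complete: "\<And>f. f \<in> falg X \<Longrightarrow> \<forall>u\<in>keys f. length u > 0 \<Longrightarrow>
      \<exists>F. (\<forall>w. F w \<in> falg X) \<and> f = (\<Sum>w\<in>B 1. F w * boundary w [])"
    and cplx: "\<And>d w u. w \<in> B (Suc (Suc d)) \<Longrightarrow> u \<in> B d \<Longrightarrow> (\<Sum>v\<in>B (Suc d). boundary w v * boundary v u) \<in> I"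
    and exact: "\<And>d F. \<forall>w. F w \<in> falg X \<Longrightarrow>
      \<forall>u\<in>B d. (\<Sum>v\<in>B (Suc d). F v * boundary v u) \<in> I \<Longrightarrow>
      \<exists>H. (\<forall>w. H w \<in> falg X) \<and>
        (\<forall>v\<in>B (Suc d). F v - (\<Sum>w\<in>B (Suc (Suc d)). H w * boundary w v) \<in> I)"
  shows "koszul X R"
proof -
  let ?P = "presented_algebra X R"
  \<comment> \<open>\<open>emb\<close> sends a lifted family to its element of the free module, and
    \<open>bd\<close> is the differential on lifts; \<open>map_emb\<close> says that the two are
    compatible.\<close>
  define emb where "emb S F = (\<lambda>b. if b \<in> S then cls (F b) else cls 0)"
    for S and F :: "'g list \<Rightarrow> ('g, 'k) free_alg"
  define bd where "bd d F = (\<lambda>v. \<Sum>w\<in>B (Suc d). F w * boundary w v)"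
    for d and F :: "'g list \<Rightarrow> ('g, 'k) free_alg"
  define D where "D = (\<lambda>(d::nat) w v. cls (boundary w v))"
  have ddT: "boundary w v \<in> falg X" if "w \<in> B (Suc d)" for d w v
    using boundary[OF that] boundary_zero[OF that] by (cases "v \<in> B d") auto
  have bdT: "bd d F v \<in> falg X" if "\<forall>w. F w \<in> falg X" for d F v
    unfolding bd_def by (intro falg_sum falg_mult that[rule_format] ddT)
  have bd_out: "bd d F v = 0" if "v \<notin> B d" for d F v
    unfolding bd_def using that by (auto intro!: sum.neutral simp: boundary_zero)
  have modB: "free_module ?P (B d) = {emb (B d) F | F. \<forall>w. F w \<in> falg X}" for d
    unfolding free_module_cls[OF fin] emb_def ..
  have map_emb: "free_map ?P (B (Suc d)) (D d) (emb (B (Suc d)) F) = emb (B d) (bd d F)"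
    if F: "\<forall>w. F w \<in> falg X" for d F
  proof
    fix c
    have "free_map ?P (B (Suc d)) (D d) (emb (B (Suc d)) F) c = cls (bd d F c)"
      unfolding emb_def bd_def D_def by (rule free_map_cls) (use F fin ddT in auto)
    then show "free_map ?P (B (Suc d)) (D d) (emb (B (Suc d)) F) c = emb (B d) (bd d F) c"
      using bd_out by (simp add: emb_def)
  qed
  have emb_eq: "emb S F = emb S G \<longleftrightarrow> (\<forall>b\<in>S. F b - G b \<in> I)"
    if "\<forall>w. F w \<in> falg X" "\<forall>w. G w \<in> falg X" for S F G
    unfolding emb_def fun_eq_iff using cls_eq_iff that by auto
  have emb_0: "emb S F = (\<lambda>_. \<zero>\<^bsub>?P\<^esub>) \<longleftrightarrow> (\<forall>b\<in>S. F b \<in> I)"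
    if "\<forall>w. F w \<in> falg X" for S F
  proof -
    have "emb S (\<lambda>_. 0) = (\<lambda>_. \<zero>\<^bsub>?P\<^esub>)"
      by (auto simp: emb_def presented_algebra_simps)
    then show ?thesis
      using emb_eq[OF that, of "\<lambda>_. 0" S] by simp
  qed
  have emb_mod: "emb (B d) F \<in> free_module ?P (B d)" if "\<forall>w. F w \<in> falg X" for d F
    unfolding modB using that by blast
  have bd_bd: "bd d (bd (Suc d) H) u \<in> I" if H: "\<forall>w. H w \<in> falg X" and u: "u \<in> B d" for d H u
  proof -
    have "bd d (bd (Suc d) H) u =
        (\<Sum>v\<in>B (Suc d). \<Sum>w\<in>B (Suc (Suc d)). H w * (boundary w v * boundary v u))"
      by (simp add: bd_def sum_distrib_right mult.assoc)
    also have "\<dots> = (\<Sum>w\<in>B (Suc (Suc d)). H w * (\<Sum>v\<in>B (Suc d). boundary w v * boundary v u))"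
      by (subst sum.swap) (simp add: sum_distrib_left)
    also have "\<dots> \<in> I"
      by (intro I_sum I_mult_left cplx u H[rule_format])
    finally show ?thesis .
  qed
  have cond1: "D d w \<in> free_module ?P (B d) \<and> (\<forall>v\<in>B d. D d w v \<in> graded_component X R 1)"
    if w: "w \<in> B (Suc d)" for d w
  proof
    have "D d w = emb (B d) (boundary w)"
      using boundary_zero[OF w] by (auto simp: D_def emb_def fun_eq_iff)
    then show "D d w \<in> free_module ?P (B d)"
      using emb_mod ddT[OF w] by auto
    show "\<forall>v\<in>B d. D d w v \<in> graded_component X R 1"
      unfolding D_def graded_component_def cls_def[symmetric]
      using boundary[OF w] boundary_degree[OF w] by auto
  qed
  have cond2: "free_map ?P (B 1) (D 0) ` free_module ?P (B 1) =
      {f \<in> free_module ?P (B 0). f [] \<in> augmentation_ideal X R}"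
  proof (intro subset_antisym subsetI)
    fix f assume "f \<in> free_map ?P (B 1) (D 0) ` free_module ?P (B 1)"
    then obtain F where F: "\<forall>w. F w \<in> falg X" and f: "f = emb (B 0) (bd 0 F)"
      using modB[of 1] map_emb[of _ 0] by auto
    have "f [] = cls (bd 0 F [])"
      using f B0 by (simp add: emb_def)
    moreover have "\<forall>u\<in>keys (bd 0 F []). length u > 0"
      using aug_sound[OF F] by (simp add: bd_def)
    ultimately show "f \<in> {f \<in> free_module ?P (B 0). f [] \<in> augmentation_ideal X R}"
      using emb_mod[of "bd 0 F" 0] bdT[OF F] f
      unfolding augmentation_ideal_def cls_def[symmetric] by auto
  next
    fix f assume "f \<in> {f \<in> free_module ?P (B 0). f [] \<in> augmentation_ideal X R}"
    then obtain F t where F: "\<forall>w. F w \<in> falg X" "f = emb (B 0) F"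
      and t: "t \<in> falg X" "\<forall>u\<in>keys t. length u > 0" "f [] = cls t"
      unfolding modB augmentation_ideal_def cls_def[symmetric] by auto
    obtain G where G: "\<forall>w. G w \<in> falg X" "t = bd 0 G []"
      using aug_complete[OF t(1,2)] unfolding bd_def by auto
    have "f = emb (B 0) (bd 0 G)"
      using F t G B0 by (auto simp: emb_def fun_eq_iff)
    then have "f = free_map ?P (B 1) (D 0) (emb (B 1) G)"
      using map_emb[OF G(1), of 0] by simp
    then show "f \<in> free_map ?P (B 1) (D 0) ` free_module ?P (B 1)"
      using emb_mod[OF G(1)] by (rule image_eqI)
  qed
  have cond3: "free_map ?P (B (Suc (Suc d))) (D (Suc d)) ` free_module ?P (B (Suc (Suc d))) =
      {f \<in> free_module ?P (B (Suc d)). free_map ?P (B (Suc d)) (D d) f = (\<lambda>_. \<zero>\<^bsub>?P\<^esub>)}" for d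
  proof (intro subset_antisym subsetI)
    fix f assume "f \<in> free_map ?P (B (Suc (Suc d))) (D (Suc d)) ` free_module ?P (B (Suc (Suc d)))"
    then obtain H where H: "\<forall>w. H w \<in> falg X" and f: "f = emb (B (Suc d)) (bd (Suc d) H)"
      using modB[of "Suc (Suc d)"] map_emb[of _ "Suc d"] by auto
    have bH: "\<forall>w. bd (Suc d) H w \<in> falg X"
      using bdT[OF H] by blast
    have "\<forall>w. bd d (bd (Suc d) H) w \<in> falg X"
      using bdT[OF bH] by blast
    then have "emb (B d) (bd d (bd (Suc d) H)) = (\<lambda>_. \<zero>\<^bsub>?P\<^esub>)"
      using bd_bd[OF H] by (subst emb_0) auto
    then show "f \<in> {f \<in> free_module ?P (B (Suc d)). free_map ?P (B (Suc d)) (D d) f = (\<lambda>_. \<zero>\<^bsub>?P\<^esub>)}"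
      using emb_mod[OF bH] map_emb[OF bH] f by auto
  next
    fix f assume f: "f \<in> {f \<in> free_module ?P (B (Suc d)). free_map ?P (B (Suc d)) (D d) f = (\<lambda>_. \<zero>\<^bsub>?P\<^esub>)}"
    then obtain F where F: "\<forall>w. F w \<in> falg X" and fF: "f = emb (B (Suc d)) F"
      using modB by auto
    have bF: "\<forall>w. bd d F w \<in> falg X"
      using bdT[OF F] by blast
    have "\<forall>u\<in>B d. bd d F u \<in> I"
      using f emb_0[OF bF] map_emb[OF F] fF by auto
    then obtain H where H: "\<forall>w. H w \<in> falg X" and eq: "\<forall>v\<in>B (Suc d). F v - bd (Suc d) H v \<in> I"
      using exact[OF F, of d] unfolding bd_def by auto
    have bH: "\<forall>w. bd (Suc d) H w \<in> falg X"
      using bdT[OF H] by blast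
    have "f = free_map ?P (B (Suc (Suc d))) (D (Suc d)) (emb (B (Suc (Suc d))) H)"
      unfolding fF map_emb[OF H] using emb_eq[OF F bH] eq by blast
    then show "f \<in> free_map ?P (B (Suc (Suc d))) (D (Suc d)) ` free_module ?P (B (Suc (Suc d)))"
      using emb_mod[OF H] by (rule image_eqI)
  qed
  show ?thesis
    unfolding koszul_def linear_free_resolution_def
    using cond1 cond2 cond3 B0 by (intro exI[of _ B] exI[of _ D]) auto
qed

section \<open>Generation of the ideal by relations on the right\<close>

lemma right_part_mult:
  assumes "r \<in> falg X" and "lookup r [] = 0"
  shows "right_part g (h * r) = h * right_part g r"
proof -
  \<comment> \<open>Expanded by last letters, \<open>r\<close> is a left combination of generators,
    and \<open>h\<close> only multiplies the coefficients. The vanishing constant term keeps letters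
    of \<open>h\<close> itself from being split off.\<close>
  have r: "r = (\<Sum>x\<in>X. right_part x r * gen x)"
    using falg_decomp[OF finite_gens assms(1)] assms(2) by simp
  have "right_part g (h * r) = (\<Sum>x\<in>X. right_part g (h * right_part x r * gen x))"
    using arg_cong[OF r, of "\<lambda>r. right_part g (h * r)"]
    by (simp add: sum_distrib_left right_part_sum mult.assoc)
  also have "\<dots> = (if g \<in> X then h * right_part g r else 0)"
    using finite_gens by (simp add: right_part_mult_gen)
  also have "\<dots> = h * right_part g r"
  proof -
    have "right_part g r = 0" if "g \<notin> X"
      by (rule poly_mapping_eqI)
        (use assms(1) that in \<open>auto simp: lookup_right_part falg_iff in_keys_iff subset_iff\<close>)
    then show ?thesis
      by auto
  qed
  finally show ?thesis .
qed

text \<open>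
  Writing \<open>T\<close> for the free algebra and \<open>V\<close> for the span of \<open>X\<close>, this is \<open>I = T R + I V\<close>,
  that is, exactness of the complex \<open>A \<otimes> R \<rightarrow> A \<otimes> V \<rightarrow> A\<close> over \<open>A = T/I\<close>.
\<close>

lemma sum_mult_gen_in_I:
  fixes \<rho> :: "'q \<Rightarrow> ('g, 'k) free_alg"
  assumes Q: "finite Q" and R: "R \<subseteq> signed (\<rho> ` Q)"
    and \<rho>: "\<And>q. q \<in> Q \<Longrightarrow> \<rho> q \<in> I" "\<And>q. q \<in> Q \<Longrightarrow> lookup (\<rho> q) [] = 0"
    and F: "(\<Sum>g\<in>X. F g * gen g) \<in> I"
  shows "\<exists>H. (\<forall>q. H q \<in> falg X) \<and> (\<forall>g\<in>X. F g - (\<Sum>q\<in>Q. H q * right_part g (\<rho> q)) \<in> I)"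
proof -
  \<comment> \<open>\<open>J\<close> is T R + I V, with T R written through coefficients at the
    \<open>\<rho> q\<close>. It turns out to be a two-sided ideal containing \<open>R\<close>, hence
    it contains \<open>I\<close>.\<close>
  define comb where "comb H G = (\<Sum>q\<in>Q. H q * \<rho> q) + (\<Sum>g\<in>X. G g * gen g)" for H G
  define J where "J = {f. \<exists>H G. (\<forall>q. H q \<in> falg X) \<and> (\<forall>g. G g \<in> I) \<and> f = comb H G}"
  have comb_J: "comb H G \<in> J" if "\<forall>q. H q \<in> falg X" "\<forall>g. G g \<in> I" for H G
    using that unfolding J_def by blast
  have J_I: "f \<in> I" if f: "f \<in> J" for f
  proof -
    obtain H G where HG: "\<forall>q. H q \<in> falg X" "\<forall>g. G g \<in> I" and f_eq: "f = comb H G"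
      using f unfolding J_def by blast
    have "(\<Sum>q\<in>Q. H q * \<rho> q) \<in> I"
      using HG(1) \<rho>(1) by (intro I_sum I_mult_left) simp_all
    moreover have "(\<Sum>g\<in>X. G g * gen g) \<in> I"
      using HG(2) by (intro I_sum I_mult_right falg_gen) simp_all
    ultimately show ?thesis
      unfolding f_eq comb_def by (rule I_add)
  qed
  have J_add: "f + g \<in> J" if f: "f \<in> J" and g: "g \<in> J" for f g
  proof -
    obtain H G where HG: "\<forall>q. H q \<in> falg X" "\<forall>g. G g \<in> I" "f = comb H G"
      using f unfolding J_def by blast
    obtain H' G' where HG': "\<forall>q. H' q \<in> falg X" "\<forall>g. G' g \<in> I" "g = comb H' G'"
      using g unfolding J_def by blast
    have "f + g = comb (\<lambda>q. H q + H' q) (\<lambda>g. G g + G' g)"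
      unfolding HG(3) HG'(3) comb_def by (simp add: distrib_right sum.distrib)
    then show ?thesis
      using HG HG' by (simp add: comb_J falg_add I_add)
  qed
  have J_left: "t * f \<in> J" if f: "f \<in> J" and t: "t \<in> falg X" for f t
  proof -
    obtain H G where HG: "\<forall>q. H q \<in> falg X" "\<forall>g. G g \<in> I" "f = comb H G"
      using f unfolding J_def by blast
    have "t * f = comb (\<lambda>q. t * H q) (\<lambda>g. t * G g)"
      unfolding HG(3) comb_def by (simp add: distrib_left sum_distrib_left mult.assoc)
    then show ?thesis
      using HG t by (simp add: comb_J falg_mult I_mult_left)
  qed
  have J_gen: "(\<Sum>g\<in>X. G g * gen g) \<in> J" if "\<forall>g. G g \<in> I" for G
    using comb_J[of "\<lambda>_. 0" G] that by (simp add: comb_def)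
  have J_right: "f * t \<in> J" if f: "f \<in> J" and t: "t \<in> falg X" for f t
  proof -
    \<comment> \<open>Split \<open>t\<close> into its constant term, which commutes with
      \<open>f\<close>, and the terms ending in a letter \<open>g\<close>. The latter land in I V
      because \<open>J\<close> lies in \<open>I\<close>.\<close>
    let ?c = "single [] (lookup t []) :: ('g, 'k) free_alg"
    have "f * ?c = ?c * f"
    proof (induction f rule: free_alg_induct)
      case (single w c)
      show ?case
        by (simp add: mult_single plus_list_def mult.commute)
    qed (simp add: distrib_left distrib_right)
    then have "f * t = ?c * f + (\<Sum>g\<in>X. f * right_part g t * gen g)"
      using arg_cong[OF falg_decomp[OF finite_gens t], of "\<lambda>t. f * t"]
      by (simp add: distrib_left sum_distrib_left mult.assoc)
    moreover have "\<forall>g. f * right_part g t \<in> I"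
      using J_I[OF f] t by (auto intro: I_mult_right)
    ultimately show ?thesis
      using f by (auto intro!: J_add J_left J_gen)
  qed
  have "ideal J (free_algebra X)"
  proof (rule ideal_free_algebraI)
    show "0 \<in> J"
      using J_gen[of "\<lambda>_. 0"] by simp
  qed (use J_I I_closed J_add J_left J_right in auto)
  moreover have "R \<subseteq> J"
  proof
    fix r assume "r \<in> R"
    then have "r = 0 \<or> (\<exists>q\<in>Q. r = \<rho> q \<or> r = - \<rho> q)"
      using R by (auto simp: signed_def)
    then consider "r = 0" | q c where "q \<in> Q" "c \<in> falg X" "r = c * \<rho> q"
      using falg_1 falg_uminus[OF falg_1] by (metis mult_1 mult_minus1)
    then show "r \<in> J"
    proof cases
      case 1
      then show ?thesis using J_gen[of "\<lambda>_. 0"] by simp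
    next
      case 2
      then have "r = comb (\<lambda>q'. if q' = q then c else 0) (\<lambda>_. 0)"
        using Q by (simp add: comb_def if_distrib[of "\<lambda>x. x * _"] cong: if_cong)
      then show ?thesis
        using 2 by (simp add: comb_J)
    qed
  qed
  ultimately have "(\<Sum>g\<in>X. F g * gen g) \<in> J"
    using I_minimal F by blast
  then obtain H G where H: "\<forall>q. H q \<in> falg X" and G: "\<forall>g. G g \<in> I"
    and eq: "(\<Sum>g\<in>X. F g * gen g) = (\<Sum>q\<in>Q. H q * \<rho> q) + (\<Sum>g\<in>X. G g * gen g)"
    unfolding J_def comb_def by blast
  have "F g - (\<Sum>q\<in>Q. H q * right_part g (\<rho> q)) \<in> I" if g: "g \<in> X" for g
  proof -
    \<comment> \<open>Comparison of the parts that end in \<open>g\<close>.\<close>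
    have "F g = (\<Sum>q\<in>Q. H q * right_part g (\<rho> q)) + G g"
      using arg_cong[OF eq, of "right_part g"] \<rho> I_closed
      by (simp add: right_part_add right_part_sum right_part_mult right_part_mult_gen finite_gens g)
    then show ?thesis
      using G by simp
  qed
  with H show ?thesis
    by blast
qed

end

section \<open>Algebras presented by contractions of matrices\<close>

text \<open>Each node \<open>U\<close> carries a matrix of generators \<open>e U i j\<close>, and
  \<open>nd\<close>, \<open>rw\<close>, \<open>cl\<close> read off the indices, so that
  \<open>e\<close> is injective. A relation multiplies a row \<open>a\<close> in
  \<open>A U S\<close> of the matrix of \<open>U\<close> by the matrix of \<open>S\<close>, summing
  over \<open>C U S\<close> only. The shift argument below rests on its presence for every column
  \<open>l\<close> of \<open>S\<close>.\<close>

locale matrix_presentation = presentation X R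
  for X :: "'g set" and R :: "('g, 'k::field) free_alg set" +
  fixes nodes :: "'u set" and rows cols :: "'u \<Rightarrow> 'a set" and e :: "'u \<Rightarrow> 'a \<Rightarrow> 'a \<Rightarrow> 'g"
    and nd :: "'g \<Rightarrow> 'u" and rw cl :: "'g \<Rightarrow> 'a" and C A :: "'u \<Rightarrow> 'u \<Rightarrow> 'a set"
  assumes finite_nodes: "finite nodes"
    and finite_rows: "U \<in> nodes \<Longrightarrow> finite (rows U)"
    and finite_cols: "U \<in> nodes \<Longrightarrow> finite (cols U)"
    and X_eq: "X = {e U i j | U i j. U \<in> nodes \<and> i \<in> rows U \<and> j \<in> cols U}"
    and nd_e: "U \<in> nodes \<Longrightarrow> i \<in> rows U \<Longrightarrow> j \<in> cols U \<Longrightarrow> nd (e U i j) = U"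
    and rw_e: "U \<in> nodes \<Longrightarrow> i \<in> rows U \<Longrightarrow> j \<in> cols U \<Longrightarrow> rw (e U i j) = i"
    and cl_e: "U \<in> nodes \<Longrightarrow> i \<in> rows U \<Longrightarrow> j \<in> cols U \<Longrightarrow> cl (e U i j) = j"
    and C_cols: "U \<in> nodes \<Longrightarrow> S \<in> nodes \<Longrightarrow> C U S \<subseteq> cols U"
    and C_rows: "U \<in> nodes \<Longrightarrow> S \<in> nodes \<Longrightarrow> C U S \<subseteq> rows S"
    and A_rows: "U \<in> nodes \<Longrightarrow> S \<in> nodes \<Longrightarrow> A U S \<subseteq> rows U"
    and C_nonempty: "U \<in> nodes \<Longrightarrow> S \<in> nodes \<Longrightarrow> A U S \<noteq> {} \<Longrightarrow> C U S \<noteq> {}"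
    and R_eq: "signed R = signed {\<Sum>j\<in>C U S. gen (e U a j) * gen (e S j l) | U S a l.
      U \<in> nodes \<and> S \<in> nodes \<and> a \<in> A U S \<and> l \<in> cols S}"
begin

section \<open>Generators and relations in matrix form\<close>

lemma finite_A: "U \<in> nodes \<Longrightarrow> S \<in> nodes \<Longrightarrow> finite (A U S)"
  using A_rows finite_rows finite_subset by metis

lemma finite_C: "U \<in> nodes \<Longrightarrow> S \<in> nodes \<Longrightarrow> finite (C U S)"
  using C_rows finite_rows finite_subset by metis

lemma e_in_X: "U \<in> nodes \<Longrightarrow> i \<in> rows U \<Longrightarrow> j \<in> cols U \<Longrightarrow> e U i j \<in> X"
  using X_eq by blast

lemmas gen_e [intro] = falg_gen[OF e_in_X]

lemma X_cases:
  assumes "g \<in> X"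
  obtains U i j where "U \<in> nodes" "i \<in> rows U" "j \<in> cols U" "g = e U i j"
  using assms X_eq by blast

lemma e_eq_iff:
  assumes "U \<in> nodes" "i \<in> rows U" "j \<in> cols U" "U' \<in> nodes" "i' \<in> rows U'" "j' \<in> cols U'"
  shows "e U i j = e U' i' j' \<longleftrightarrow> U = U' \<and> i = i' \<and> j = j'"
  using assms nd_e rw_e cl_e by metis

lemma sum_X: "sum f X = (\<Sum>U\<in>nodes. \<Sum>i\<in>rows U. \<Sum>j\<in>cols U. f (e U i j))"
proof -
  let ?Z = "SIGMA U:nodes. rows U \<times> cols U"
  have "sum f X = (\<Sum>(U, i, j)\<in>?Z. f (e U i j))"
  proof (rule sum.reindex_bij_witness[where i = "\<lambda>(U, i, j). e U i j" and j = "\<lambda>g. (nd g, rw g, cl g)"])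
    fix g assume "g \<in> X"
    then obtain U i j where g: "U \<in> nodes" "i \<in> rows U" "j \<in> cols U" "g = e U i j"
      by (rule X_cases)
    then show "(case (nd g, rw g, cl g) of (U, i, j) \<Rightarrow> e U i j) = g"
      "(nd g, rw g, cl g) \<in> ?Z"
      "(case (nd g, rw g, cl g) of (U, i, j) \<Rightarrow> f (e U i j)) = f g"
      by (simp_all add: nd_e rw_e cl_e)
  qed (auto simp: nd_e rw_e cl_e intro: e_in_X)
  also have "\<dots> = (\<Sum>U\<in>nodes. \<Sum>i\<in>rows U. \<Sum>j\<in>cols U. f (e U i j))"
    by (subst sum.Sigma[symmetric]) (auto simp: finite_nodes finite_rows finite_cols sum.cartesian_product)
  finally show ?thesis .
qed

lemma relation_in_I:
  assumes "U \<in> nodes" "S \<in> nodes" "a \<in> A U S" "l \<in> cols S"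
  shows "(\<Sum>j\<in>C U S. gen (e U a j) * gen (e S j l)) \<in> I"
proof -
  have "(\<Sum>j\<in>C U S. gen (e U a j) * gen (e S j l)) \<in> signed R"
    unfolding R_eq using assms by (fastforce simp: signed_def)
  then show ?thesis
    using I_rel I_uminus by (auto simp: signed_def)
qed

text \<open>This is \<open>sum_mult_gen_in_I\<close> for the matrix relations: the letter
  \<open>e S j b\<close> ends a term only in relations into \<open>S\<close> with column
  \<open>b\<close> and with \<open>j\<close> in \<open>C U S\<close>, and what precedes it there is
  \<open>e U a j\<close>.\<close>

lemma sum_gen_in_I_coeffs:
  assumes "(\<Sum>g\<in>X. F g * gen g) \<in> I"
  shows "\<exists>h. (\<forall>U S a b. h U S a b \<in> falg X) \<and> (\<forall>S\<in>nodes. \<forall>b\<in>cols S. \<forall>j\<in>rows S.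
    F (e S j b) - (\<Sum>U\<in>nodes. \<Sum>a\<in>A U S. if j \<in> C U S then h U S a b * gen (e U a j) else 0) \<in> I)"
proof -
  define Q where "Q = (SIGMA U:nodes. SIGMA S:nodes. A U S \<times> cols S)"
  define \<rho> :: "'u \<times> 'u \<times> 'a \<times> 'a \<Rightarrow> ('g, 'k) free_alg"
    where "\<rho> = (\<lambda>(U, S, a, l). \<Sum>j\<in>C U S. gen (e U a j) * gen (e S j l))"
  have "finite Q"
    unfolding Q_def by (intro finite_SigmaI finite_nodes finite_A finite_cols)
  moreover have "R \<subseteq> signed (\<rho> ` Q)"
  proof -
    have "{\<Sum>j\<in>C U S. gen (e U a j) * gen (e S j l) | U S a l.
        U \<in> nodes \<and> S \<in> nodes \<and> a \<in> A U S \<and> l \<in> cols S} = \<rho> ` Q"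
      by (force simp: Q_def \<rho>_def image_iff)
    then show ?thesis
      using R_eq by (auto simp: signed_def)
  qed
  moreover have "\<rho> q \<in> I" if "q \<in> Q" for q
    using that relation_in_I by (auto simp: Q_def \<rho>_def)
  moreover have "lookup (\<rho> q) [] = 0" if "q \<in> Q" for q
    by (auto simp: \<rho>_def lookup_sum lookup_mult_gen split: prod.split)
  ultimately obtain H where H: "\<forall>q. H q \<in> falg X"
    and FH: "\<forall>g\<in>X. F g - (\<Sum>q\<in>Q. H q * right_part g (\<rho> q)) \<in> I"
    using sum_mult_gen_in_I[OF _ _ _ _ assms, of Q \<rho>] by blast
  have right_sum: "(\<Sum>q\<in>Q. H q * right_part (e S j b) (\<rho> q)) =
      (\<Sum>U\<in>nodes. \<Sum>a\<in>A U S. if j \<in> C U S then H (U, S, a, b) * gen (e U a j) else 0)"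
    if S: "S \<in> nodes" and b: "b \<in> cols S" and j: "j \<in> rows S" for S b j
  proof -
    \<comment> \<open>By injectivity of \<open>e\<close>, at most one summation index produces the
      last letter \<open>e S j b\<close>.\<close>
    have right: "right_part (e S j b) (\<rho> (U, S', a, l)) =
        (if S' = S then if l = b then if j \<in> C U S then gen (e U a j) else 0 else 0 else 0)"
      if q: "U \<in> nodes" "S' \<in> nodes" "a \<in> A U S'" "l \<in> cols S'" for U S' a l
    proof -
      have "right_part (e S j b) (\<rho> (U, S', a, l)) =
          (\<Sum>j'\<in>C U S'. if e S' j' l = e S j b then gen (e U a j') else 0)"
        by (simp add: \<rho>_def right_part_sum right_part_mult_gen)
      also have "\<dots> = (\<Sum>j'\<in>C U S'. if j = j' then if S' = S \<and> l = b then gen (e U a j) else 0 else 0)"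
        using q S b j C_rows by (intro sum.cong refl) (auto simp: e_eq_iff subset_iff)
      also have "\<dots> = (if S' = S then if l = b then if j \<in> C U S then gen (e U a j) else 0 else 0 else 0)"
        using q finite_C by auto
      finally show ?thesis .
    qed
    have "(\<Sum>q\<in>Q. H q * right_part (e S j b) (\<rho> q)) =
        (\<Sum>U\<in>nodes. \<Sum>S'\<in>nodes. \<Sum>a\<in>A U S'. \<Sum>l\<in>cols S'.
          H (U, S', a, l) * right_part (e S j b) (\<rho> (U, S', a, l)))"
      unfolding Q_def
      by (simp add: sum.Sigma sum.cartesian_product finite_nodes finite_A finite_cols split_def)
    also have "\<dots> = (\<Sum>U\<in>nodes. \<Sum>S'\<in>nodes. if S' = S then \<Sum>a\<in>A U S. \<Sum>l\<in>cols S. if l = b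
        then if j \<in> C U S then H (U, S, a, b) * gen (e U a j) else 0 else 0 else 0)"
      by (auto intro!: sum.cong sum.neutral simp: right)
    also have "\<dots> = (\<Sum>U\<in>nodes. \<Sum>a\<in>A U S. if j \<in> C U S then H (U, S, a, b) * gen (e U a j) else 0)"
      using S b finite_nodes finite_cols by simp
    finally show ?thesis .
  qed
  have "F (e S j b) - (\<Sum>U\<in>nodes. \<Sum>a\<in>A U S. if j \<in> C U S then H (U, S, a, b) * gen (e U a j) else 0) \<in> I"
    if "S \<in> nodes" "b \<in> cols S" "j \<in> rows S" for S b j
    using FH e_in_X[OF that(1,3,2)] right_sum[OF that] by metis
  with H show ?thesis
    by (intro exI[of _ "\<lambda>U S a b. H (U, S, a, b)"]) blast
qed

text \<open>
  By the shape of the relations, the index \<open>b\<close> of the last letter plays no role in a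
  linear relation between the letters \<open>e S j b\<close>.
\<close>

lemma sum_gen_in_I_shift:
  assumes F: "(\<Sum>g\<in>X. F g * gen g) \<in> I"
    and S: "S \<in> nodes" and b: "b \<in> cols S" and c: "c \<in> cols S"
  shows "(\<Sum>j\<in>rows S. F (e S j b) * gen (e S j c)) \<in> I"
proof -
  obtain h where h: "\<forall>U S a b. h U S a b \<in> falg X" and eq: "\<forall>S\<in>nodes. \<forall>b\<in>cols S. \<forall>j\<in>rows S.
    F (e S j b) - (\<Sum>U\<in>nodes. \<Sum>a\<in>A U S. if j \<in> C U S then h U S a b * gen (e U a j) else 0) \<in> I"
    using sum_gen_in_I_coeffs[OF F] by blast
  define G where "G j = (\<Sum>U\<in>nodes. \<Sum>a\<in>A U S. if j \<in> C U S then h U S a b * gen (e U a j) else 0)" for j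
  have "(\<Sum>j\<in>rows S. F (e S j b) * gen (e S j c)) - (\<Sum>j\<in>rows S. G j * gen (e S j c)) =
      (\<Sum>j\<in>rows S. (F (e S j b) - G j) * gen (e S j c))"
    by (simp add: left_diff_distrib sum_subtractf)
  also have "\<dots> \<in> I"
    using eq S b c unfolding G_def by (intro I_sum I_mult_right gen_e) auto
  finally have "(\<Sum>j\<in>rows S. F (e S j b) * gen (e S j c)) \<in> I \<longleftrightarrow>
      (\<Sum>j\<in>rows S. G j * gen (e S j c)) \<in> I"
    by (rule I_cong)
  \<comment> \<open>The coefficients were obtained in column \<open>b\<close>, but the relation of
    \<open>U\<close>, \<open>S\<close>, \<open>a\<close> exists in every column, so the same
    coefficients combine the relations in column \<open>c\<close>.\<close>
  moreover have "(\<Sum>j\<in>rows S. G j * gen (e S j c)) =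
      (\<Sum>U\<in>nodes. \<Sum>a\<in>A U S. h U S a b * (\<Sum>j\<in>C U S. gen (e U a j) * gen (e S j c)))"
  proof -
    have "(\<Sum>j\<in>rows S. G j * gen (e S j c)) = (\<Sum>U\<in>nodes. \<Sum>a\<in>A U S. \<Sum>j\<in>rows S.
        if j \<in> C U S then h U S a b * (gen (e U a j) * gen (e S j c)) else 0)"
      unfolding G_def sum_distrib_right
      by (subst sum.swap, rule sum.cong[OF refl], subst sum.swap, rule sum.cong[OF refl],
          rule sum.cong[OF refl]) (simp add: mult.assoc)
    also have "\<dots> = (\<Sum>U\<in>nodes. \<Sum>a\<in>A U S. \<Sum>j\<in>C U S. h U S a b * (gen (e U a j) * gen (e S j c)))"
    proof (rule sum.cong[OF refl], rule sum.cong[OF refl])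
      fix U a assume "U \<in> nodes"
      then have "rows S \<inter> C U S = C U S" "finite (rows S)"
        using C_rows S finite_rows by auto
      then show "(\<Sum>j\<in>rows S. if j \<in> C U S then h U S a b * (gen (e U a j) * gen (e S j c)) else 0) =
          (\<Sum>j\<in>C U S. h U S a b * (gen (e U a j) * gen (e S j c)))"
        by (simp add: sum.inter_restrict[symmetric])
    qed
    finally show ?thesis
      by (simp add: sum_distrib_left)
  qed
  moreover have "\<dots> \<in> I"
    using h S c by (intro I_sum I_mult_left relation_in_I) auto
  ultimately show ?thesis
    by simp
qed

text \<open>Packs coefficients indexed by a node and a row into one function on letters, supported
  in column \<open>l\<close>, so that the preceding lemmas on sums over \<open>X\<close>
  apply.\<close>

lemma sum_gen_filter:
  assumes "\<And>U. U \<in> nodes \<Longrightarrow> P U \<Longrightarrow> l \<in> cols U" and "\<And>U. U \<in> nodes \<Longrightarrow> K U \<subseteq> rows U"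
  shows "(\<Sum>g\<in>X. (if cl g = l \<and> P (nd g) \<and> rw g \<in> K (nd g) then h (nd g) (rw g) else 0) * gen g) =
    (\<Sum>U\<in>nodes. \<Sum>a\<in>K U. if P U then h U a * gen (e U a l) else 0)"
proof -
  have row_sum: "(\<Sum>i\<in>rows U. \<Sum>j\<in>cols U. (if cl (e U i j) = l \<and> P (nd (e U i j)) \<and> rw (e U i j) \<in> K (nd (e U i j))
      then h (nd (e U i j)) (rw (e U i j)) else 0) * gen (e U i j)) =
      (\<Sum>a\<in>K U. if P U then h U a * gen (e U a l) else 0)" if U: "U \<in> nodes" for U
  proof -
    have "(\<Sum>i\<in>rows U. \<Sum>j\<in>cols U. (if cl (e U i j) = l \<and> P (nd (e U i j)) \<and> rw (e U i j) \<in> K (nd (e U i j))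
        then h (nd (e U i j)) (rw (e U i j)) else 0) * gen (e U i j)) =
        (\<Sum>i\<in>rows U. \<Sum>j\<in>cols U. if j = l then if P U \<and> i \<in> K U then h U i * gen (e U i l) else 0 else 0)"
      using U by (intro sum.cong refl) (auto simp: nd_e rw_e cl_e)
    also have "\<dots> = (\<Sum>i\<in>rows U. if i \<in> K U then if P U then h U i * gen (e U i l) else 0 else 0)"
      using U assms(1) finite_cols by (intro sum.cong refl) auto
    also have "\<dots> = (\<Sum>i\<in>rows U \<inter> K U. if P U then h U i * gen (e U i l) else 0)"
      using U finite_rows by (simp add: sum.inter_restrict)
    also have "rows U \<inter> K U = K U"
      using U assms(2) by auto
    finally show ?thesis .
  qed
  show ?thesis
    unfolding sum_X by (rule sum.cong[OF refl row_sum])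
qed

section \<open>Basis and differential of the Koszul complex\<close>

definition pivot :: "'u \<Rightarrow> 'u \<Rightarrow> 'a" where
  "pivot U S = (SOME j. j \<in> C U S)"

lemma pivot_in_C: "U \<in> nodes \<Longrightarrow> S \<in> nodes \<Longrightarrow> a \<in> A U S \<Longrightarrow> pivot U S \<in> C U S"
  unfolding pivot_def using C_nonempty by (metis empty_iff some_in_eq)

text \<open>
  The basis element \<open>w(a; U\<^sub>0, \<dots>, U\<^sub>d; b)\<close> of the Koszul complex is encoded by one of its words, in which
  every summation index is replaced by a fixed element of its range.
\<close>

inductive basis_word :: "'g list \<Rightarrow> bool" where
  Nil: "basis_word []"
| single: "g \<in> X \<Longrightarrow> basis_word [g]"
| Cons: "U \<in> nodes \<Longrightarrow> S \<in> nodes \<Longrightarrow> a \<in> A U S \<Longrightarrow> b \<in> cols S \<Longrightarrow>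
    \<forall>j\<in>C U S. basis_word (e S j b # w) \<Longrightarrow> basis_word (e U a (pivot U S) # e S (pivot U S) b # w)"

definition basis_words :: "nat \<Rightarrow> 'g list set" where
  "basis_words d = {w. basis_word w \<and> length w = d}"

text \<open>The matrix of the differential that sends
  \<open>w(a; U\<^sub>0, U\<^sub>1, \<dots>; b)\<close> to the sum of the
  \<open>x\<^sub>a\<^sub>j w(j; U\<^sub>1, \<dots>; b)\<close>. In the encoding, passing from the
  pivot to a general \<open>j\<close> changes only the row of the second letter. So a target is the
  tail of the source with that row replaced by some \<open>j\<close> in the contraction
  range.\<close>

fun boundary :: "'g list \<Rightarrow> 'g list \<Rightarrow> ('g, 'k) free_alg" where
  "boundary [g] [] = gen g"
| "boundary (g # g' # w) (v # w') =
    (if w = w' \<and> rw v \<in> C (nd g) (nd g') \<and> v = e (nd g') (rw v) (cl g')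
     then gen (e (nd g) (rw g) (rw v)) else 0)"
| "boundary _ _ = 0"

lemma pivot_cols: "U \<in> nodes \<Longrightarrow> S \<in> nodes \<Longrightarrow> a \<in> A U S \<Longrightarrow> pivot U S \<in> cols U"
  and pivot_rows: "U \<in> nodes \<Longrightarrow> S \<in> nodes \<Longrightarrow> a \<in> A U S \<Longrightarrow> pivot U S \<in> rows S"
  using pivot_in_C C_cols C_rows by blast+

lemma basis_word_in_lists: "basis_word w \<Longrightarrow> w \<in> lists X"
proof (induction rule: basis_word.induct)
  case (Cons U S a b w)
  then have "e S (pivot U S) b # w \<in> lists X"
    using pivot_in_C by blast
  moreover have "e U a (pivot U S) \<in> X"
    using Cons A_rows pivot_cols by (blast intro: e_in_X)
  ultimately show ?case
    by simp
qed auto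

lemma finite_basis_words: "finite (basis_words d)"
  unfolding basis_words_def
  by (rule finite_subset[OF _ finite_lists_length_eq[OF finite_gens, of d]])
    (use basis_word_in_lists in auto)

lemma basis_words_0: "basis_words 0 = {[]}"
  by (auto simp: basis_words_def intro: basis_word.Nil)

lemma basis_words_1: "basis_words 1 = (\<lambda>g. [g]) ` X"
proof (intro subset_antisym subsetI)
  fix w assume "w \<in> basis_words 1"
  then show "w \<in> (\<lambda>g. [g]) ` X"
    using basis_word_in_lists[of w] by (auto simp: basis_words_def length_Suc_conv)
qed (auto simp: basis_words_def intro: basis_word.single)

lemma basis_word_ConsE:
  assumes "basis_word (g # g' # w)"
  obtains U S a b where "U \<in> nodes" "S \<in> nodes" "a \<in> A U S" "b \<in> cols S"
    "\<forall>j\<in>C U S. basis_word (e S j b # w)" "g = e U a (pivot U S)" "g' = e S (pivot U S) b"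
  using assms by (cases rule: basis_word.cases) auto

lemma boundary_Cons:
  assumes "U \<in> nodes" "S \<in> nodes" "a \<in> A U S" "b \<in> cols S"
  shows "boundary (e U a (pivot U S) # e S (pivot U S) b # w) (v # w') =
    (if w = w' \<and> rw v \<in> C U S \<and> v = e S (rw v) b then gen (e U a (rw v)) else 0)"
  using assms A_rows[of U S] pivot_cols[OF assms(1-3)] pivot_rows[OF assms(1-3)]
  by (auto simp: nd_e rw_e cl_e subset_iff)

declare boundary.simps(2) [simp del]

lemma basis_words_sum_1: "(\<Sum>w\<in>basis_words 1. F w * boundary w []) = (\<Sum>g\<in>X. F [g] * gen g)"
  unfolding basis_words_1 by (subst sum.reindex) (auto simp: inj_on_def)

text \<open>The sources with a nonzero entry at \<open>e S j b # w'\<close> are parametrized by the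
  node \<open>U\<close> and row \<open>a\<close> of the letter put in front. The quantifier over
  \<open>j'\<close> is the condition of \<open>basis_word.Cons\<close> for the longer word.\<close>

lemma basis_words_sum_boundary:
  assumes S: "S \<in> nodes" and j: "j \<in> rows S" and b: "b \<in> cols S" and d: "d = Suc (Suc (length w'))"
  shows "(\<Sum>w\<in>basis_words d. H w * boundary w (e S j b # w')) =
    (\<Sum>U\<in>nodes. \<Sum>a\<in>A U S. if j \<in> C U S \<and> (\<forall>j'\<in>C U S. basis_word (e S j' b # w'))
      then H (e U a (pivot U S) # e S (pivot U S) b # w') * gen (e U a j) else 0)"
proof -
  define ok where "ok U \<longleftrightarrow> j \<in> C U S \<and> (\<forall>j'\<in>C U S. basis_word (e S j' b # w'))" for U
  define \<phi> where "\<phi> = (\<lambda>(U, a). e U a (pivot U S) # e S (pivot U S) b # w')"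
  define Z where "Z = (SIGMA U:nodes. A U S)"
  define Z' where "Z' = {z \<in> Z. ok (fst z)}"
  have Z: "finite Z"
    unfolding Z_def using S by (intro finite_SigmaI finite_nodes finite_A)
  have inj: "inj_on \<phi> Z'"
  proof (rule inj_onI)
    fix y z assume yz: "y \<in> Z'" "z \<in> Z'" "\<phi> y = \<phi> z"
    obtain U a U' a' where "y = (U, a)" "z = (U', a')"
      by (cases y; cases z) auto
    moreover from this yz have "e U a (pivot U S) = e U' a' (pivot U' S)"
      and "U \<in> nodes" "a \<in> A U S" "U' \<in> nodes" "a' \<in> A U' S"
      by (auto simp: \<phi>_def Z'_def Z_def)
    ultimately show "y = z"
      using S A_rows[of U S] A_rows[of U' S] pivot_cols[of U S a] pivot_cols[of U' S a']
        e_eq_iff[of U a "pivot U S" U' a' "pivot U' S"] by blast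
  qed
  have sub: "\<phi> ` Z' \<subseteq> basis_words d"
    using S b d by (auto simp: \<phi>_def Z'_def Z_def ok_def basis_words_def intro: basis_word.Cons)
  \<comment> \<open>A nonzero entry would force the second letter to have node \<open>S\<close> and
    column \<open>b\<close>, and the rest to be \<open>w'\<close>; this puts the word into the image
    of \<open>\<phi>\<close>.\<close>
  have zero: "H w * boundary w (e S j b # w') = 0" if w: "w \<in> basis_words d - \<phi> ` Z'" for w
  proof -
    obtain g g' w'' where gw: "w = g # g' # w''"
      using w d by (auto simp: basis_words_def length_Suc_conv)
    then have "basis_word (g # g' # w'')"
      using w by (auto simp: basis_words_def)
    then obtain U T a l where U: "U \<in> nodes" "T \<in> nodes" "a \<in> A U T" "l \<in> cols T"
      and bw: "\<forall>j\<in>C U T. basis_word (e T j l # w'')"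
      and gg: "g = e U a (pivot U T)" "g' = e T (pivot U T) l"
      by (rule basis_word_ConsE)
    have "w'' = w' \<and> j \<in> C U T \<and> e S j b = e T j l \<Longrightarrow> False"
    proof -
      assume *: "w'' = w' \<and> j \<in> C U T \<and> e S j b = e T j l"
      then have "S = T" "b = l"
        using U S j b C_rows[of U T] e_eq_iff[of S j b T j l] by auto
      then have "(U, a) \<in> Z'" "w = \<phi> (U, a)"
        using * U bw gw gg by (auto simp: Z'_def Z_def ok_def \<phi>_def)
      then show False
        using w by blast
    qed
    then show ?thesis
      unfolding gw gg boundary_Cons[OF U] using S j b by (auto simp: rw_e)
  qed
  have "(\<Sum>w\<in>basis_words d. H w * boundary w (e S j b # w')) = (\<Sum>w\<in>\<phi> ` Z'. H w * boundary w (e S j b # w'))"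
    using zero by (intro sum.mono_neutral_right finite_basis_words sub) auto
  also have "\<dots> = (\<Sum>z\<in>Z'. H (\<phi> z) * boundary (\<phi> z) (e S j b # w'))"
    using sum.reindex[OF inj] by simp
  also have "\<dots> = (\<Sum>z\<in>Z'. H (\<phi> z) * gen (e (fst z) (snd z) j))"
  proof (rule sum.cong[OF refl])
    fix z assume "z \<in> Z'"
    then have "fst z \<in> nodes" "snd z \<in> A (fst z) S" "j \<in> C (fst z) S"
      by (auto simp: Z'_def Z_def ok_def)
    then show "H (\<phi> z) * boundary (\<phi> z) (e S j b # w') = H (\<phi> z) * gen (e (fst z) (snd z) j)"
      using boundary_Cons[of "fst z" S "snd z" b] S j b by (simp add: \<phi>_def split_def rw_e)
  qed
  also have "\<dots> = (\<Sum>z\<in>Z. if ok (fst z) then H (\<phi> z) * gen (e (fst z) (snd z) j) else 0)"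
    unfolding Z'_def using Z by (rule sum.inter_filter)
  also have "\<dots> = (\<Sum>U\<in>nodes. \<Sum>a\<in>A U S. if ok U then H (\<phi> (U, a)) * gen (e U a j) else 0)"
    using S unfolding Z_def by (subst sum.Sigma) (auto simp: finite_nodes finite_A split_def cong: if_cong)
  finally show ?thesis
    unfolding \<phi>_def ok_def prod.case .
qed

text \<open>Each matrix entry of the squared differential is zero or a single defining relation: the
  first step exposes the summation index \<open>j\<close>, the second fixes the column, which is
  \<open>rw y\<close>, or \<open>b\<close> at the end of the word.\<close>

lemma boundary_dd_in_I:
  assumes w: "w \<in> basis_words (Suc (Suc d))" and u: "u \<in> basis_words d"
  shows "(\<Sum>v\<in>basis_words (Suc d). boundary w v * boundary v u) \<in> I"
proof -
  obtain g g' w'' where gw: "w = g # g' # w''"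
    using w by (auto simp: basis_words_def length_Suc_conv)
  then have "basis_word (g # g' # w'')"
    using w by (auto simp: basis_words_def)
  then obtain U S a b where U: "U \<in> nodes" "S \<in> nodes" "a \<in> A U S" "b \<in> cols S"
    and bw: "\<forall>j\<in>C U S. basis_word (e S j b # w'')"
    and gg: "g = e U a (pivot U S)" "g' = e S (pivot U S) b"
    by (rule basis_word_ConsE)
  have rows: "j \<in> rows S" if "j \<in> C U S" for j
    using C_rows U that by blast
  let ?v = "\<lambda>j. e S j b # w''"
  have inj: "inj_on ?v (C U S)"
    using U rows by (auto simp: inj_on_def e_eq_iff)
  have sub: "?v ` C U S \<subseteq> basis_words (Suc d)"
    using bw w gw by (auto simp: basis_words_def)
  have "boundary w v * boundary v u = 0" if v: "v \<in> basis_words (Suc d) - ?v ` C U S" for v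
  proof -
    obtain x v' where "v = x # v'"
      using v by (auto simp: basis_words_def length_Suc_conv)
    then show ?thesis
      unfolding gw gg using v by (auto simp: boundary_Cons[OF U])
  qed
  then have "(\<Sum>v\<in>basis_words (Suc d). boundary w v * boundary v u) = (\<Sum>v\<in>?v ` C U S. boundary w v * boundary v u)"
    by (intro sum.mono_neutral_right finite_basis_words sub) auto
  also have "\<dots> = (\<Sum>j\<in>C U S. boundary w (?v j) * boundary (?v j) u)"
    using sum.reindex[OF inj] by simp
  also have "\<dots> = (\<Sum>j\<in>C U S. gen (e U a j) * boundary (?v j) u)"
    unfolding gw gg using U rows by (intro sum.cong refl) (simp add: boundary_Cons[OF U] rw_e)
  also have "\<dots> \<in> I"
  proof (cases w'')
    case Nil
    then have "u = []"
      using w u gw by (auto simp: basis_words_def)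
    then show ?thesis
      using Nil U relation_in_I by simp
  next
    case (Cons g2 w2)
    \<comment> \<open>Any \<open>j0\<close> in the range reveals the next node \<open>T\<close>, and
      that \<open>b\<close> is the pivot of \<open>S\<close> and \<open>T\<close>.\<close>
    obtain j0 where "j0 \<in> C U S"
      using U C_nonempty by blast
    then have "basis_word (e S j0 b # g2 # w2)"
      using bw Cons by blast
    then obtain S' T a' b' where T: "S' \<in> nodes" "T \<in> nodes" "a' \<in> A S' T" "b' \<in> cols T"
      and eq: "e S j0 b = e S' a' (pivot S' T)" "g2 = e T (pivot S' T) b'"
      by (rule basis_word_ConsE)
    have S': "S' = S" "b = pivot S T"
      using eq(1) T U rows[OF \<open>j0 \<in> C U S\<close>] A_rows[OF T(1,2)] pivot_cols[OF T(1-3)]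
        e_eq_iff[of S j0 b S' a' "pivot S' T"] by auto
    obtain y u' where uy: "u = y # u'"
      using u w gw Cons by (cases u) (auto simp: basis_words_def)
    \<comment> \<open>The condition does not involve \<open>j\<close>, so it can be taken out of the
      sum.\<close>
    define ok where "ok \<longleftrightarrow> w2 = u' \<and> rw y \<in> C S T \<and> y = e T (rw y) b'"
    have "boundary (?v j) u = (if ok then gen (e S j (rw y)) else 0)" if "j \<in> C U S" for j
    proof -
      have "pivot S T \<in> cols S" "pivot S T \<in> rows T"
        using pivot_cols pivot_rows T S' by blast+
      then show ?thesis
        using T U S' rows[OF that] unfolding Cons uy eq ok_def
        by (auto simp: boundary.simps(2) nd_e rw_e cl_e)
    qed
    then have "(\<Sum>j\<in>C U S. gen (e U a j) * boundary (?v j) u) =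
        (if ok then \<Sum>j\<in>C U S. gen (e U a j) * gen (e S j (rw y)) else 0)"
      by simp
    also have "\<dots> \<in> I"
      using relation_in_I[OF U(1-3), of "rw y"] C_cols[of S T] T S' by (auto simp: ok_def)
    finally show ?thesis .
  qed
  finally show ?thesis .
qed

lemma boundary_properties:
  assumes w: "w \<in> basis_words (Suc d)"
  shows "boundary w v \<in> falg X" "u \<in> keys (boundary w v) \<Longrightarrow> length u = 1" "v \<notin> basis_words d \<Longrightarrow> boundary w v = 0"
proof -
  \<comment> \<open>All three claims follow from this: an entry is zero or a generator, and a
    generator only at a target that is itself a basis word.\<close>
  have "(\<exists>g\<in>X. boundary w v = gen g \<and> v \<in> basis_words d) \<or> boundary w v = 0"
  proof (cases d)
    case 0
    then obtain g where "g \<in> X" "w = [g]"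
      using w basis_words_1 by auto
    then show ?thesis
      using 0 basis_words_0 by (cases v) auto
  next
    case (Suc d')
    then obtain g g' w'' where gw: "w = g # g' # w''"
      using w by (auto simp: basis_words_def length_Suc_conv)
    then have "basis_word (g # g' # w'')"
      using w by (auto simp: basis_words_def)
    then obtain U S a b where U: "U \<in> nodes" "S \<in> nodes" "a \<in> A U S" "b \<in> cols S"
      and bw: "\<forall>j\<in>C U S. basis_word (e S j b # w'')"
      and gg: "g = e U a (pivot U S)" "g' = e S (pivot U S) b"
      by (rule basis_word_ConsE)
    show ?thesis
    proof (cases v)
      case Nil
      then show ?thesis by (simp add: gw)
    next
      case (Cons y v')
      have "e U a (rw y) \<in> X" if "rw y \<in> C U S"
        using that U A_rows[of U S] C_cols[of U S] by (auto intro: e_in_X)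
      moreover have "v \<in> basis_words d" if "rw y \<in> C U S" "y = e S (rw y) b" "w'' = v'"
      proof -
        have "basis_word (e S (rw y) b # w'')"
          using that bw by blast
        then show ?thesis
          using that(2,3) Cons w gw by (auto simp: basis_words_def)
      qed
      ultimately show ?thesis
        unfolding gw gg Cons boundary_Cons[OF U] by auto
    qed
  qed
  then show "boundary w v \<in> falg X" "v \<notin> basis_words d \<Longrightarrow> boundary w v = 0"
    and "u \<in> keys (boundary w v) \<Longrightarrow> length u = 1"
    using falg_gen by (auto, auto simp: gen_def)
qed

section \<open>Exactness of the Koszul complex\<close>

text \<open>
  A vector of coefficients along the letters \<open>e S j b\<close> that is supported on the rows \<open>K\<close>
  needs only those relations \<open>C U S\<close> that live on \<open>K\<close>: any other one has an entry outside
  \<open>K\<close>, which has to vanish, and then the whole relation contributes nothing.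
\<close>

lemma restrict_relations:
  assumes S: "S \<in> nodes" and K: "\<And>j. j \<in> rows S \<Longrightarrow> j \<notin> K \<Longrightarrow> f j = 0"
    and h: "\<And>U a. h U a \<in> falg X"
    and f: "\<And>j. j \<in> rows S \<Longrightarrow>
      f j - (\<Sum>U\<in>nodes. \<Sum>a\<in>A U S. if j \<in> C U S then h U a * gen (e U a j) else 0) \<in> I"
    and j: "j \<in> rows S"
  shows "f j - (\<Sum>U\<in>nodes. \<Sum>a\<in>A U S. if j \<in> C U S \<and> C U S \<subseteq> K then h U a * gen (e U a j) else 0) \<in> I"
proof -
  have drop: "(\<Sum>a\<in>A U S. h U a * gen (e U a j)) \<in> I"
    if U: "U \<in> nodes" and bad: "\<not> C U S \<subseteq> K" and jU: "j \<in> cols U" for U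
  proof -
    obtain k where k: "k \<in> C U S" "k \<notin> K"
      using bad by blast
    have kS: "k \<in> rows S" "k \<in> cols U"
      using k C_rows C_cols U S by blast+
    \<comment> \<open>Since \<open>f k\<close> is zero, the relations passing through row
      \<open>k\<close> of \<open>S\<close> sum to an element of \<open>I\<close>. The shift lemma
      isolates the node \<open>U\<close> in this sum and moves it from column \<open>k\<close> to
      column \<open>j\<close>.\<close>
    define G where "G g = (if cl g = k \<and> k \<in> C (nd g) S \<and> rw g \<in> A (nd g) S then h (nd g) (rw g) else 0)" for g
    have "(\<Sum>g\<in>X. G g * gen g) =
        (\<Sum>U\<in>nodes. \<Sum>a\<in>A U S. if k \<in> C U S then h U a * gen (e U a k) else 0)"
      unfolding G_def by (rule sum_gen_filter) (use C_cols A_rows S in blast)+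
    also have "\<dots> \<in> I"
      using f[OF kS(1)] I_uminus K[OF kS(1) k(2)] by fastforce
    finally have "(\<Sum>i\<in>rows U. G (e U i k) * gen (e U i j)) \<in> I"
      using sum_gen_in_I_shift U kS(2) jU by blast
    also have "(\<Sum>i\<in>rows U. G (e U i k) * gen (e U i j)) =
        (\<Sum>i\<in>rows U. if i \<in> A U S then h U i * gen (e U i j) else 0)"
      using U kS k by (intro sum.cong refl) (auto simp: G_def nd_e rw_e cl_e)
    also have "\<dots> = (\<Sum>i\<in>rows U \<inter> A U S. h U i * gen (e U i j))"
      using U finite_rows by (simp add: sum.inter_restrict)
    also have "rows U \<inter> A U S = A U S"
      using A_rows U S by blast
    finally show ?thesis .
  qed
  have "(\<Sum>U\<in>nodes. \<Sum>a\<in>A U S. if j \<in> C U S then h U a * gen (e U a j) else 0) -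
      (\<Sum>U\<in>nodes. \<Sum>a\<in>A U S. if j \<in> C U S \<and> C U S \<subseteq> K then h U a * gen (e U a j) else 0) =
      (\<Sum>U\<in>nodes. if j \<in> C U S \<and> \<not> C U S \<subseteq> K then \<Sum>a\<in>A U S. h U a * gen (e U a j) else 0)"
    unfolding sum_subtractf[symmetric] by (intro sum.cong[OF refl]) auto
  also have "\<dots> \<in> I"
    using drop C_cols S by (intro I_sum) (auto simp: subset_iff)
  finally show ?thesis
    using f[OF j] I_trans by blast
qed

text \<open>With the tail \<open>w\<close> and the node and column of the first letter fixed, the
  values of a cycle form a vector over the row \<open>j\<close>. The cycle condition at the target
  \<open>w\<close> is a left combination of letters lying in \<open>I\<close>, and
  \<open>sum_gen_in_I_coeffs\<close> expands this vector in relations into \<open>S\<close>. Rows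
  that give no basis word count as zero.\<close>

lemma tail_coefficients:
  assumes F: "\<forall>w. F w \<in> falg X"
    and cycle: "\<forall>u\<in>basis_words d. (\<Sum>v\<in>basis_words (Suc d). F v * boundary v u) \<in> I"
    and S: "S \<in> nodes" and b: "b \<in> cols S" and d: "length w = d"
  shows "\<exists>h. (\<forall>U a. h U a \<in> falg X) \<and> (\<forall>j\<in>rows S.
    (if basis_word (e S j b # w) then F (e S j b # w) else 0) -
      (\<Sum>U\<in>nodes. \<Sum>a\<in>A U S. if j \<in> C U S then h U a * gen (e U a j) else 0) \<in> I)"
proof (cases "\<exists>j\<in>rows S. basis_word (e S j b # w)")
  case False
  then show ?thesis
    by (intro exI[of _ "\<lambda>_ _. 0"]) (simp cong: if_cong)
next
  case True
  then obtain j0 where j0: "j0 \<in> rows S" "basis_word (e S j0 b # w)"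
    by blast
  show ?thesis
  proof (cases w)
    case Nil
    have "(\<Sum>g\<in>X. F [g] * gen g) \<in> I"
      using cycle d Nil basis_words_0 basis_words_sum_1[of F] by simp
    then obtain h where "\<forall>U S a b. h U S a b \<in> falg X" "\<forall>S\<in>nodes. \<forall>b\<in>cols S. \<forall>j\<in>rows S.
        F [e S j b] - (\<Sum>U\<in>nodes. \<Sum>a\<in>A U S. if j \<in> C U S then h U S a b * gen (e U a j) else 0) \<in> I"
      using sum_gen_in_I_coeffs[of "\<lambda>g. F [g]"] by blast
    moreover have "basis_word [e S j b]" if "j \<in> rows S" for j
      using that S b by (intro basis_word.single e_in_X)
    ultimately show ?thesis
      using S b Nil by (intro exI[of _ "\<lambda>U a. h U S a b"]) simp
  next
    case (Cons g' w'')
    obtain S' T a b' where T: "S' \<in> nodes" "T \<in> nodes" "a \<in> A S' T" "b' \<in> cols T"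
      and bw: "\<forall>l\<in>C S' T. basis_word (e T l b' # w'')"
      and eq: "e S j0 b = e S' a (pivot S' T)" "g' = e T (pivot S' T) b'"
      using j0(2) unfolding Cons by (rule basis_word_ConsE)
    have S': "S' = S" "b = pivot S T"
      using eq(1) T S b j0(1) A_rows[OF T(1,2)] pivot_cols[OF T(1-3)]
        e_eq_iff[of S j0 b S' a "pivot S' T"] by auto
    note T = T[unfolded S'(1)] and bw = bw[unfolded S'(1)]
    have w_eq: "w = e T (pivot S T) b' # w''"
      using Cons eq(2) S' by simp
    have pivot: "pivot S T \<in> C S T" "pivot S T \<in> rows T" "pivot S T \<in> cols S"
      using T pivot_in_C pivot_rows pivot_cols by blast+
    \<comment> \<open>The rows that can stand in front of \<open>w\<close> are those allowed by the
      next node \<open>T\<close>.\<close>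
    have basis_word_iff: "basis_word (e S j b # w) \<longleftrightarrow> j \<in> A S T" if j: "j \<in> rows S" for j
    proof
      assume "j \<in> A S T"
      then show "basis_word (e S j b # w)"
        unfolding w_eq S'(2) using S T bw by (intro basis_word.Cons)
    next
      assume "basis_word (e S j b # w)"
      then obtain S1 T1 a1 b1 where T1: "S1 \<in> nodes" "T1 \<in> nodes" "a1 \<in> A S1 T1" "b1 \<in> cols T1"
        and eq1: "e S j b = e S1 a1 (pivot S1 T1)" "e T (pivot S T) b' = e T1 (pivot S1 T1) b1"
        unfolding w_eq by (rule basis_word_ConsE)
      have "S1 = S" "a1 = j"
        using eq1(1) T1 S b j A_rows[OF T1(1,2)] pivot_cols[OF T1(1-3)]
          e_eq_iff[of S j b S1 a1 "pivot S1 T1"] by auto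
      moreover have "T1 = T"
        using eq1(2) T1 T pivot pivot_rows[OF T1(1-3)] e_eq_iff[of T "pivot S T" b' T1 "pivot S1 T1" b1] by auto
      ultimately show "j \<in> A S T"
        using T1 by simp
    qed
    \<comment> \<open>\<open>P U\<close> says that words with first node \<open>U\<close> can have a
      nonzero entry at the target \<open>w\<close>. \<open>f U i\<close> is the value of the cycle
      on such a word, whose second letter sits in the pivot row of \<open>U\<close> and
      \<open>T\<close> instead of \<open>S\<close> and \<open>T\<close>.\<close>
    define P where "P U \<longleftrightarrow> pivot S T \<in> C U T \<and> (\<forall>l\<in>C U T. basis_word (e T l b' # w''))" for U
    define f where "f U i = F (e U i (pivot U T) # e T (pivot U T) b' # w'')" for U i
    define G where "G g = (if cl g = pivot S T \<and> P (nd g) \<and> rw g \<in> A (nd g) T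
      then f (nd g) (rw g) else 0)" for g
    have "(\<Sum>g\<in>X. G g * gen g) =
        (\<Sum>U\<in>nodes. \<Sum>i\<in>A U T. if P U then f U i * gen (e U i (pivot S T)) else 0)"
      unfolding G_def by (rule sum_gen_filter) (use C_cols A_rows T in \<open>auto simp: P_def\<close>)
    also have "\<dots> = (\<Sum>v\<in>basis_words (Suc d). F v * boundary v w)"
      unfolding w_eq using d w_eq T pivot
      by (subst basis_words_sum_boundary) (simp_all add: P_def f_def cong: if_cong)
    also have "\<dots> \<in> I"
      using cycle bw pivot(1) d w_eq by (auto simp: basis_words_def)
    finally obtain h where h: "\<forall>U S a b. h U S a b \<in> falg X" and hG: "\<forall>S\<in>nodes. \<forall>b\<in>cols S. \<forall>j\<in>rows S.
        G (e S j b) - (\<Sum>U\<in>nodes. \<Sum>a\<in>A U S. if j \<in> C U S then h U S a b * gen (e U a j) else 0) \<in> I"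
      using sum_gen_in_I_coeffs by blast
    \<comment> \<open>For the node \<open>S\<close> itself the pivot is \<open>b\<close>, so these
      words are the original \<open>e S j b # w\<close>.\<close>
    have "G (e S j b) = (if basis_word (e S j b # w) then F (e S j b # w) else 0)" if j: "j \<in> rows S" for j
      unfolding basis_word_iff[OF j]
      using S b j S'(2) pivot(1) bw by (simp add: G_def P_def f_def nd_e rw_e cl_e w_eq)
    moreover have "G (e S j b) - (\<Sum>U\<in>nodes. \<Sum>a\<in>A U S. if j \<in> C U S then h U S a b * gen (e U a j) else 0) \<in> I"
      if "j \<in> rows S" for j
      using hG S b that by blast
    ultimately show ?thesis
      using h by (intro exI[of _ "\<lambda>U a. h U S a b"]) simp
  qed
qed

text \<open>Basis words are grouped by tail and by node and column of the first letter.
  \<open>tail_coefficients\<close> expands the cycle in relations on each group, and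
  \<open>restrict_relations\<close> keeps the relations whose whole range consists of rows giving
  basis words. By \<open>basis_word.Cons\<close> these correspond to basis words one degree higher,
  so the expansion is a boundary.\<close>

lemma boundary_exact:
  assumes F: "\<forall>w. F w \<in> falg X"
    and cycle: "\<forall>u\<in>basis_words d. (\<Sum>v\<in>basis_words (Suc d). F v * boundary v u) \<in> I"
  shows "\<exists>H. (\<forall>w. H w \<in> falg X) \<and> (\<forall>v\<in>basis_words (Suc d).
    F v - (\<Sum>w\<in>basis_words (Suc (Suc d)). H w * boundary w v) \<in> I)"
proof -
  define good where "good h S b w \<longleftrightarrow> (\<forall>U a. h U a \<in> falg X) \<and> (\<forall>j\<in>rows S.
    (if basis_word (e S j b # w) then F (e S j b # w) else 0) -
      (\<Sum>U\<in>nodes. \<Sum>a\<in>A U S. if j \<in> C U S then h U a * gen (e U a j) else 0) \<in> I)"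
    for h :: "'u \<Rightarrow> 'a \<Rightarrow> ('g, 'k) free_alg" and S b w
  \<comment> \<open>One choice of coefficients for every group. Membership in the free algebra is
    demanded for all indices, so that \<open>H\<close> below is a valid family on all words.\<close>
  define h where "h S b w = (SOME h. (\<forall>U a. h U a \<in> falg X) \<and>
    (S \<in> nodes \<and> b \<in> cols S \<and> length w = d \<longrightarrow> good h S b w))" for S b w
  have h_some: "(\<forall>U a. h S b w U a \<in> falg X) \<and>
      (S \<in> nodes \<and> b \<in> cols S \<and> length w = d \<longrightarrow> good (h S b w) S b w)" for S b w
  proof -
    have "\<exists>h. (\<forall>U a. h U a \<in> falg X) \<and> (S \<in> nodes \<and> b \<in> cols S \<and> length w = d \<longrightarrow> good h S b w)"
    proof (cases "S \<in> nodes \<and> b \<in> cols S \<and> length w = d")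
      case True
      then show ?thesis
        using tail_coefficients[OF F cycle, of S b w] unfolding good_def by blast
    next
      case False
      then show ?thesis
        by (intro exI[of _ "\<lambda>_ _. 0"]) auto
    qed
    then show ?thesis
      unfolding h_def by (rule someI_ex)
  qed
  then have h: "h S b w U a \<in> falg X" for S b w U a
    by simp
  \<comment> \<open>The indices are read off the word: the first letter gives \<open>U\<close> and
    \<open>a\<close>, the second gives \<open>S\<close> and \<open>b\<close>, the rest is the
    tail.\<close>
  define H where "H w = h (nd (w ! 1)) (cl (w ! 1)) (drop 2 w) (nd (w ! 0)) (rw (w ! 0))" for w
  have "F v - (\<Sum>w\<in>basis_words (Suc (Suc d)). H w * boundary w v) \<in> I" if v: "v \<in> basis_words (Suc d)" for v
  proof -
    obtain g w where gw: "v = g # w"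
      using v by (auto simp: basis_words_def length_Suc_conv)
    have "length w = d" "g \<in> X"
      using v basis_word_in_lists[of v] gw by (auto simp: basis_words_def)
    from \<open>g \<in> X\<close> obtain S j b where S: "S \<in> nodes" "j \<in> rows S" "b \<in> cols S" and g: "g = e S j b"
      by (rule X_cases)
    let ?K = "{j. basis_word (e S j b # w)}"
    have bw: "basis_word (e S j b # w)"
      using v gw g by (simp add: basis_words_def)
    have gd: "good (h S b w) S b w"
      using h_some S \<open>length w = d\<close> by blast
    have restr: "(if basis_word (e S j b # w) then F (e S j b # w) else 0) -
        (\<Sum>U\<in>nodes. \<Sum>a\<in>A U S. if j \<in> C U S \<and> C U S \<subseteq> ?K then h S b w U a * gen (e U a j) else 0) \<in> I"
      by (rule restrict_relations[where f = "\<lambda>j. if basis_word (e S j b # w) then F (e S j b # w) else 0",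
            OF S(1) _ h _ S(2)]) (use gd in \<open>simp_all add: good_def\<close>)
    have "(\<Sum>U\<in>nodes. \<Sum>a\<in>A U S. if j \<in> C U S \<and> C U S \<subseteq> ?K then h S b w U a * gen (e U a j) else 0) =
        (\<Sum>w\<in>basis_words (Suc (Suc d)). H w * boundary w v)"
      unfolding gw g basis_words_sum_boundary[OF S refl[of "Suc (Suc (length w))"], unfolded \<open>length w = d\<close>]
    proof (rule sum.cong[OF refl], rule sum.cong[OF refl])
      fix U a assume U: "U \<in> nodes" "a \<in> A U S"
      then have "H (e U a (pivot U S) # e S (pivot U S) b # w) = h S b w U a"
        using S A_rows[of U S] pivot_cols[of U S a] pivot_rows[of U S a]
        by (simp add: H_def nd_e rw_e cl_e subset_iff)
      then show "(if j \<in> C U S \<and> C U S \<subseteq> ?K then h S b w U a * gen (e U a j) else 0) =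
          (if j \<in> C U S \<and> (\<forall>j'\<in>C U S. basis_word (e S j' b # w))
           then H (e U a (pivot U S) # e S (pivot U S) b # w) * gen (e U a j) else 0)"
        by auto
    qed
    then show ?thesis
      using restr bw gw g by simp
  qed
  then show ?thesis
    using h by (intro exI[of _ H]) (simp add: H_def)
qed

theorem koszul_matrix_presentation: "koszul X R"
proof (rule koszulI[of basis_words boundary])
  show "basis_words 0 = {[]}"
    by (rule basis_words_0)
  show "length u > 0" if "u \<in> keys (\<Sum>w\<in>basis_words 1. F w * boundary w [])" for F u
  proof -
    from that have "u \<in> keys (\<Sum>g\<in>X. F [g] * gen g)"
      unfolding basis_words_sum_1 .
    from subsetD[OF keys_sum this] obtain g where "u \<in> keys (F [g] * gen g)"
      by (rule UN_E)
    then show ?thesis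
      by (rule keys_mult_gen_length)
  qed
  show "\<exists>F. (\<forall>w. F w \<in> falg X) \<and> f = (\<Sum>w\<in>basis_words 1. F w * boundary w [])"
    if f: "f \<in> falg X" "\<forall>u\<in>keys f. length u > 0" for f
  proof -
    have const: "lookup f [] = 0"
      using f(2) by (auto simp: in_keys_iff)
    \<comment> \<open>The basis words of degree 1 are the single letters, so the coefficient at
      \<open>[g]\<close> is the part of \<open>f\<close> in front of a last letter
      \<open>g\<close>.\<close>
    have "f = (\<Sum>w\<in>basis_words 1. right_part (hd w) f * boundary w [])"
      using falg_decomp[OF finite_gens f(1)]
      unfolding basis_words_sum_1 const list.sel single_zero add_0_left .
    moreover have "\<forall>w. right_part (hd w) f \<in> falg X"
      using f(1) by blast
    ultimately show ?thesis
      by (intro exI[of _ "\<lambda>w. right_part (hd w) f"] conjI)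
  qed
  show "finite (basis_words d)" for d
    by (rule finite_basis_words)
  show "boundary w v \<in> falg X" if "w \<in> basis_words (Suc d)" for d w v
    by (rule boundary_properties(1)[OF that])
  show "length u = 1" if "w \<in> basis_words (Suc d)" "u \<in> keys (boundary w v)" for d w v u
    by (rule boundary_properties(2)[OF that])
  show "boundary w v = 0" if "w \<in> basis_words (Suc d)" "v \<notin> basis_words d" for d w v
    by (rule boundary_properties(3)[OF that])
  show "(\<Sum>v\<in>basis_words (Suc d). boundary w v * boundary v u) \<in> I"
    if "w \<in> basis_words (Suc (Suc d))" "u \<in> basis_words d" for d w u
    by (rule boundary_dd_in_I[OF that])
  show "\<exists>H. (\<forall>w. H w \<in> falg X) \<and>
      (\<forall>v\<in>basis_words (Suc d). F v - (\<Sum>w\<in>basis_words (Suc (Suc d)). H w * boundary w v) \<in> I)"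
    if "\<forall>w. F w \<in> falg X" "\<forall>u\<in>basis_words d. (\<Sum>v\<in>basis_words (Suc d). F v * boundary v u) \<in> I" for d F
    by (rule boundary_exact[OF that])
qed

end

section \<open>Quasi-Pluecker coordinates\<close>

lemma lookup_hom_part: "lookup (hom_part d f) w = (if length w = d then lookup f w else 0)"
proof -
  have "lookup (hom_part d f) w =
      (\<Sum>v\<in>{v \<in> keys f. length v = d}. if v = w then lookup f v else 0)"
    unfolding hom_part_def lookup_sum lookup_single when_def ..
  also have "\<dots> = (if length w = d then lookup f w else 0)"
    by (simp add: in_keys_iff)
  finally show ?thesis .
qed

lemma hom_part_linear:
  "hom_part d (f + g) = hom_part d f + hom_part d g"
  "hom_part d (f - g) = hom_part d f - hom_part d g"
  "hom_part d 0 = 0"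
  "hom_part d (sum F S) = (\<Sum>i\<in>S. hom_part d (F i))"
  by (rule poly_mapping_eqI; simp add: lookup_hom_part lookup_add lookup_minus lookup_sum)+

lemma hom_part_single: "hom_part d (single w c) = (if length w = d then single w c else 0)"
  by (rule poly_mapping_eqI) (auto simp: lookup_hom_part lookup_single when_def)

lemma hom_part_2_gen [simp]: "hom_part 2 (gen g) = 0"
  by (simp add: gen_def hom_part_single)

lemma hom_part_2_gen_gen [simp]: "hom_part 2 (gen g * gen h) = gen g * gen h"
  by (simp add: gen_def mult_single plus_list_def hom_part_single)

lemma hom_part_2_one [simp]: "hom_part 2 1 = 0"
  by (simp add: single_one[symmetric] hom_part_single zero_list_def del: single_one)

lemma hom_part_2_qp [simp]: "hom_part 2 (qp i j I) = 0"
  by (simp add: qp_def hom_part_linear)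

text \<open>With a factor 0 or 1 no word of length 2 is left, so a quadratic part arises only when
  both factors are generators.\<close>

lemma hom_part_2_qp_qp:
  "hom_part 2 (qp i j I * qp j' l J) =
    (if j \<in> I \<or> i = j \<or> l \<in> J \<or> j' = l then 0 else gen (i, j, I) * gen (j', l, J))"
  by (simp add: qp_def hom_part_linear)

section \<open>The length filtration, and the relations as elements of degree at most 2\<close>

definition words_le :: "nat \<Rightarrow> 'g set \<Rightarrow> ('g, 'k::field) free_alg set" where
  "words_le d X = {f \<in> falg X. \<forall>w\<in>keys f. length w \<le> d}"

lemma words_le_iff: "f \<in> words_le d X \<longleftrightarrow> (\<forall>w. lookup f w \<noteq> 0 \<longrightarrow> w \<in> lists X \<and> length w \<le> d)"
  by (auto simp: words_le_def falg_iff in_keys_iff)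

lemma words_le_0: "0 \<in> words_le d X"
  by (simp add: words_le_iff)

lemma words_le_add: "f \<in> words_le d X \<Longrightarrow> g \<in> words_le d X \<Longrightarrow> f + g \<in> words_le d X"
  using keys_add[of f g] by (auto simp: words_le_def)

lemma words_le_diff:
  assumes "f \<in> words_le d X" and "g \<in> words_le d X"
  shows "f - g \<in> words_le d X"
proof -
  have "- g \<in> words_le d X"
    using assms(2) by (simp add: words_le_iff)
  from words_le_add[OF assms(1) this] show ?thesis
    by simp
qed

lemma words_le_sum: "(\<And>i. i \<in> S \<Longrightarrow> F i \<in> words_le d X) \<Longrightarrow> sum F S \<in> words_le d X"
  by (induction S rule: infinite_finite_induct) (auto intro: words_le_add words_le_0)

lemma words_le_mult:
  assumes "f \<in> words_le d X" and "g \<in> words_le d' X"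
  shows "f * g \<in> words_le (d + d') X"
proof -
  have "length w \<le> d + d'" if "w \<in> keys (f * g)" for w
  proof -
    from subsetD[OF keys_mult that] obtain u v where "w = u @ v" and uv: "u \<in> keys f" "v \<in> keys g"
      unfolding plus_list_def mem_Collect_eq by (elim exE conjE)
    then have "length w = length u + length v" "length u \<le> d" "length v \<le> d'"
      using assms by (simp_all add: words_le_def)
    then show ?thesis
      by simp
  qed
  moreover have "f * g \<in> falg X"
    using assms by (intro falg_mult) (simp_all add: words_le_def)
  ultimately show ?thesis
    by (simp add: words_le_def)
qed

lemma words_le_mono: "d \<le> d' \<Longrightarrow> f \<in> words_le d X \<Longrightarrow> f \<in> words_le d' X"
  by (auto simp: words_le_def)

lemma qp_words_le: "j \<in> I \<or> i = j \<or> (i, j, I) \<in> X \<Longrightarrow> qp i j I \<in> words_le 1 X"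
  unfolding qp_def by (auto simp: words_le_def gen_def falg_iff zero_list_def split: if_splits)

lemma qp_words_le_2: "j \<in> I \<or> i = j \<or> (i, j, I) \<in> X \<Longrightarrow> qp i j I \<in> words_le 2 X"
  by (rule words_le_mono[OF _ qp_words_le]) auto

lemma qp_qp_words_le:
  assumes "j \<in> I \<or> i = j \<or> (i, j, I) \<in> X" and "l \<in> J \<or> j' = l \<or> (j', l, J) \<in> X"
  shows "qp i j I * qp j' l J \<in> words_le 2 X"
  using words_le_mult[OF qp_words_le[OF assms(1)] qp_words_le[OF assms(2)]] by (simp add: numeral_2_eq_2)

lemma Q_rels_words_le:
  assumes "k \<ge> 1"
  shows "Q_rels n k \<subseteq> words_le 2 (Q_gens n k)"
  unfolding Q_rels_def
proof (intro Un_least subsetI; elim CollectE exE conjE)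
  fix r :: "(qgen, 'k::field) free_alg" and i j l I
  assume r: "r = qp i j I * qp j l I - qp i l I"
    and *: "i \<in> {1..n}" "j \<in> {1..n}" "l \<in> {1..n}" "I \<subseteq> {1..n}" "card I = k - 1" "i \<notin> I" "j \<notin> I"
  have gens: "a \<in> I \<or> b = a \<or> (b, a, I) \<in> Q_gens n k" if "b \<in> {1..n} - I" "a \<in> {1..n}" for a b
    using that * by (auto simp: Q_gens_def)
  show "r \<in> words_le 2 (Q_gens n k)"
    unfolding r using * by (intro words_le_diff qp_qp_words_le qp_words_le_2 gens) auto
next
  fix r :: "(qgen, 'k::field) free_alg" and i l L M
  assume r: "r = (\<Sum>j\<in>L - {i, l}. qp i j M * qp j l (L - {j, l})) + qp i l (L - {i, l}) - qp i l M"
    and *: "L \<subseteq> {1..n}" "card L = k + 1" "i \<in> L" "l \<in> L" "i \<noteq> l" "M \<subseteq> {1..n}" "card M = k - 1" "i \<notin> M"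
  have "finite L"
    using *(1) finite_subset by blast
  then have "card (L - {j, l}) = k - 1" if "j \<in> L" "j \<noteq> l" for j
    using * that by (simp add: card_Diff_subset)
  then have gens1: "l \<in> L - {j, l} \<or> j = l \<or> (j, l, L - {j, l}) \<in> Q_gens n k" if "j \<in> L" "j \<noteq> l" for j
    using * that by (auto simp: Q_gens_def)
  have gens2: "j \<in> M \<or> i = j \<or> (i, j, M) \<in> Q_gens n k" if "j \<in> L" for j
    using * that by (auto simp: Q_gens_def)
  show "r \<in> words_le 2 (Q_gens n k)"
    unfolding r using *
    by (intro words_le_diff words_le_add words_le_sum qp_qp_words_le qp_words_le_2 gens1 gens2) auto
qed

lemma Q_le_rels_words_le: "Q_le_rels n k \<subseteq> words_le 2 (Q_le_gens n k)"
  unfolding Q_le_rels_def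
proof (intro Un_least UN_least)
  fix k' assume k': "k' \<in> {2..k}"
  have "Q_rels n k' \<subseteq> words_le 2 (Q_gens n k')"
    using k' by (intro Q_rels_words_le) simp
  also have "Q_gens n k' \<subseteq> Q_le_gens n k"
    unfolding Q_le_gens_def using k' by blast
  then have "words_le 2 (Q_gens n k') \<subseteq> words_le 2 (Q_le_gens n k)"
    unfolding words_le_iff subset_iff in_lists_conv_set by blast
  finally show "Q_rels n k' \<subseteq> words_le 2 (Q_le_gens n k)" .
next
  show "{qp i j J - (qp i j (J \<union> {m}) + qp i m J * qp m j (J \<union> {i})) | i j m J.
       i \<in> {1..n} \<and> j \<in> {1..n} \<and> m \<in> {1..n} \<and> J \<subseteq> {1..n} \<and>
       i \<noteq> m \<and> i \<notin> J \<and> m \<notin> J \<and> 1 \<le> card J \<and> card J \<le> k - 2}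
    \<subseteq> words_le 2 (Q_le_gens n k)"
  proof (intro subsetI; elim CollectE exE conjE)
    fix r :: "(qgen, 'k::field) free_alg" and i j m J
    assume r: "r = qp i j J - (qp i j (J \<union> {m}) + qp i m J * qp m j (J \<union> {i}))"
      and *: "i \<in> {1..n}" "j \<in> {1..n}" "m \<in> {1..n}" "J \<subseteq> {1..n}" "i \<noteq> m" "i \<notin> J" "m \<notin> J"
        "1 \<le> card J" "card J \<le> k - 2"
    have "finite J"
      using *(4) finite_subset by blast
    have gens: "b \<in> I \<or> a = b \<or> (a, b, I) \<in> Q_le_gens n k"
      if "a \<in> {1..n} - I" "b \<in> {1..n}" "I \<subseteq> {1..n}" "1 \<le> card I" "card I \<le> k - 1" for a b I
    proof -
      have "b \<in> I \<or> a = b \<or> (a, b, I) \<in> Q_gens n (Suc (card I))"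
        using that by (auto simp: Q_gens_def)
      moreover have "Suc (card I) \<in> {2..k}"
        using that by auto
      ultimately show ?thesis
        unfolding Q_le_gens_def by blast
    qed
    have "card (J \<union> {x}) = Suc (card J)" if "x \<notin> J" for x
      using that \<open>finite J\<close> by simp
    then show "r \<in> words_le 2 (Q_le_gens n k)"
      unfolding r using *
      by (intro words_le_diff words_le_add qp_qp_words_le qp_words_le_2 gens) auto
  qed
qed

section \<open>Generators and contractions of the quasi-Pluecker algebras in matrix form\<close>

definition entry :: "nat set \<Rightarrow> nat \<Rightarrow> nat \<Rightarrow> qgen" where
  "entry U i j = (i, j, U - {i})"

text \<open>The rows \<open>A U S\<close>. For distinct sets of equal size, relation (v') supplies
  the rows in \<open>U \<inter> S\<close>; if the sets differ in one element, relation (iii)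
  supplies the one remaining row. For \<open>S = U \<union> {m}\<close> the relation between
  neighbouring levels supplies every row.\<close>

definition contracted_rows :: "nat set \<Rightarrow> nat set \<Rightarrow> nat set" where
  "contracted_rows U S =
    (if card (S - U) = 1 \<and> (card S = card U \<or> U \<subseteq> S) then U
     else if card S = card U \<and> U \<noteq> S then U \<inter> S else {})"

definition contraction :: "nat set \<Rightarrow> nat set \<Rightarrow> nat \<Rightarrow> nat \<Rightarrow> (qgen, 'k::field) free_alg" where
  "contraction U S a l = (\<Sum>j\<in>S - U. gen (entry U a j) * gen (entry S j l))"

text \<open>\<open>K\<close> collects the admissible sizes: a singleton for one level, an interval
  for the quotient of the free product.\<close>

definition nodes_of :: "nat \<Rightarrow> nat set \<Rightarrow> nat set set" where
  "nodes_of n K = {U. U \<subseteq> {1..n} \<and> card U \<in> K}"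

definition entries :: "nat \<Rightarrow> nat set \<Rightarrow> qgen set" where
  "entries n K = {entry U i j | U i j. U \<in> nodes_of n K \<and> i \<in> U \<and> j \<in> {1..n} - U}"

definition contractions :: "nat \<Rightarrow> nat set \<Rightarrow> (qgen, 'k::field) free_alg set" where
  "contractions n K = {contraction U S a l | U S a l.
    U \<in> nodes_of n K \<and> S \<in> nodes_of n K \<and> a \<in> contracted_rows U S \<and> l \<in> {1..n} - S}"

lemma contracted_rows_subset: "contracted_rows U S \<subseteq> U"
  by (auto simp: contracted_rows_def)

lemma contraction_nonempty:
  assumes "finite S" "finite U" "contracted_rows U S \<noteq> {}"
  shows "S - U \<noteq> {}"
proof
  assume "S - U = {}"
  then have "card S = card U" "U \<noteq> S" "S \<subseteq> U"
    using assms(3) by (auto simp: contracted_rows_def split: if_splits)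
  then show False
    using assms(2) card_subset_eq by metis
qed

text \<open>The matrix of \<open>U\<close> has rows \<open>U\<close> and columns in the complement,
  so its columns meet the rows of \<open>S\<close> exactly in the contraction range
  \<open>S - U\<close>.\<close>

lemma koszul_contractions:
  fixes R :: "(qgen, 'k::field) free_alg set"
  assumes "signed R = signed (contractions n K)"
  shows "koszul (entries n K) R"
proof -
  have fin: "finite U" "U \<subseteq> {1..n}" if "U \<in> nodes_of n K" for U
    using that finite_subset by (auto simp: nodes_of_def)
  have nodes: "finite (nodes_of n K)"
    by (rule finite_subset[of _ "Pow {1..n}"]) (auto simp: nodes_of_def)
  have gens: "finite (entries n K)"
  proof -
    have "entries n K \<subseteq> {1..n} \<times> {1..n} \<times> Pow {1..n}"
      by (auto simp: entries_def entry_def nodes_of_def)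
    then show ?thesis
      by (rule finite_subset) auto
  qed
  have entry_in: "entry U i j \<in> entries n K" if "U \<in> nodes_of n K" "i \<in> U" "j \<in> {1..n} - U" for U i j
    using that unfolding entries_def by blast
  have closed: "c \<in> falg (entries n K)" if c: "c \<in> contractions n K" for c :: "(qgen, 'k) free_alg"
  proof -
    obtain U S a l where c_eq: "c = contraction U S a l" and US: "U \<in> nodes_of n K" "S \<in> nodes_of n K"
      and a: "a \<in> contracted_rows U S" and l: "l \<in> {1..n} - S"
      using c unfolding contractions_def by blast
    have "a \<in> U"
      using a contracted_rows_subset by blast
    then show ?thesis
      unfolding c_eq contraction_def using US l fin(2)[OF US(2)]
      by (intro falg_sum falg_mult falg_gen entry_in) auto
  qed
  have rels: "R \<subseteq> falg (entries n K)"
  proof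
    fix r assume "r \<in> R"
    then have "r \<in> signed (contractions n K)"
      unfolding assms[symmetric] by (simp add: signed_def)
    then show "r \<in> falg (entries n K)"
      using closed by (auto simp: signed_def)
  qed
  have signed_R: "signed R = signed {\<Sum>j\<in>S - U. gen (entry U a j) * gen (entry S j l) | U S a l.
      U \<in> nodes_of n K \<and> S \<in> nodes_of n K \<and> a \<in> contracted_rows U S \<and> l \<in> {1..n} - S}"
    using assms unfolding contractions_def contraction_def .
  interpret matrix_presentation "entries n K" R "nodes_of n K" "\<lambda>U. U" "\<lambda>U. {1..n} - U"
    entry "\<lambda>(i, j, I). insert i I" "\<lambda>(i, j, I). i" "\<lambda>(i, j, I). j" "\<lambda>U S. S - U" contracted_rows
  proof (unfold_locales, fact gens, fact rels, fact nodes, rule fin(1), assumption)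
    show "S - U \<noteq> {}" if "U \<in> nodes_of n K" "S \<in> nodes_of n K" "contracted_rows U S \<noteq> {}" for U S
      using contraction_nonempty that fin(1) by blast
    show "contracted_rows U S \<subseteq> U" for U S
      by (rule contracted_rows_subset)
    show "S - U \<subseteq> {1..n} - U" if "U \<in> nodes_of n K" "S \<in> nodes_of n K" for U S
      using fin(2)[OF that(2)] by blast
  qed (use signed_R in \<open>auto simp: entries_def entry_def\<close>)
  show ?thesis
    by (rule koszul_matrix_presentation)
qed

lemma Q_gens_eq: "k \<ge> 1 \<Longrightarrow> Q_gens n k = entries n {k}"
proof (intro subset_antisym subsetI)
  fix g assume k: "k \<ge> 1" and g: "g \<in> Q_gens n k"
  obtain i j I where ijI: "g = (i, j, I)" "i \<in> {1..n}" "j \<in> {1..n}" "I \<subseteq> {1..n}" "card I = k - 1"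
    "i \<noteq> j" "i \<notin> I" "j \<notin> I"
    using g by (auto simp: Q_gens_def)
  then have "finite I"
    using finite_subset by blast
  then have "g = entry (insert i I) i j" "insert i I \<in> nodes_of n {k}"
    using ijI k by (auto simp: entry_def nodes_of_def)
  then show "g \<in> entries n {k}"
    using ijI by (auto simp: entries_def)
next
  fix g assume k: "k \<ge> 1" and g: "g \<in> entries n {k}"
  then show "g \<in> Q_gens n k"
    by (auto simp: entries_def entry_def nodes_of_def Q_gens_def)
qed

lemma Q_le_gens_eq: "Q_le_gens n k = entries n {2..k}"
proof -
  have "Q_le_gens n k = (\<Union>k'\<in>{2..k}. entries n {k'})"
    unfolding Q_le_gens_def by (intro SUP_cong refl Q_gens_eq) auto
  then show ?thesis
    unfolding entries_def nodes_of_def by blast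
qed

section \<open>Quadratic parts of the defining relations\<close>

lemma signedI: "x \<in> S \<Longrightarrow> x \<in> signed S" "- x \<in> S \<Longrightarrow> x \<in> signed S" "x = 0 \<Longrightarrow> x \<in> signed S"
  by (auto simp: signed_def image_iff) (metis minus_minus)

lemma signed_subset: "S \<subseteq> signed S' \<Longrightarrow> signed S \<subseteq> signed S'"
  by (fastforce simp: signed_def)

lemma signed_mono: "S \<subseteq> S' \<Longrightarrow> signed S \<subseteq> signed S'"
  by (auto simp: signed_def)

lemma contractions_mono:
  assumes "K \<subseteq> K'"
  shows "contractions n K \<subseteq> (contractions n K' :: (qgen, 'k::field) free_alg set)"
proof -
  have "nodes_of n K \<subseteq> nodes_of n K'"
    using assms by (auto simp: nodes_of_def)
  then show ?thesis
    unfolding contractions_def by blast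
qed

text \<open>Relation (iii) contracts over the single index \<open>j\<close>; the value 0 occurs when
  a factor is 0 or 1.\<close>

lemma hom_part_Q_triangle:
  assumes "i \<notin> I" "j \<notin> I"
  shows "hom_part 2 (qp i j I * qp j l I - qp i l I) =
    (if i = j \<or> j = l \<or> l \<in> I then 0 else contraction (insert i I) (insert j I) i l)"
proof -
  have "insert j I - insert i I = {j}" if "i \<noteq> j"
    using assms that by auto
  then show ?thesis
    using assms by (auto simp: hom_part_linear hom_part_2_qp_qp contraction_def entry_def)
qed

text \<open>In (v') the terms with \<open>j\<close> in \<open>M\<close> drop out because their first
  factor is 0. The remaining indices are those of \<open>L - {l}\<close> outside
  \<open>insert i M\<close>, which is a contraction range.\<close>

lemma hom_part_Q_sum:
  assumes "finite L" "i \<in> L" "l \<in> L" "i \<noteq> l" "i \<notin> M"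
  shows "hom_part 2 ((\<Sum>j\<in>L - {i, l}. qp i j M * qp j l (L - {j, l})) + qp i l (L - {i, l}) - qp i l M) =
    contraction (insert i M) (L - {l}) i l"
proof -
  have "hom_part 2 ((\<Sum>j\<in>L - {i, l}. qp i j M * qp j l (L - {j, l})) + qp i l (L - {i, l}) - qp i l M) =
      (\<Sum>j\<in>L - {i, l}. if j \<in> M then 0 else gen (i, j, M) * gen (j, l, L - {j, l}))"
    by (auto simp: hom_part_linear hom_part_2_qp_qp intro!: sum.cong)
  also have "\<dots> = (\<Sum>j\<in>L - {l} - insert i M. gen (i, j, M) * gen (j, l, L - {j, l}))"
    using assms(1) by (intro sum.mono_neutral_cong_right) auto
  also have "\<dots> = contraction (insert i M) (L - {l}) i l"
    unfolding contraction_def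
  proof (rule sum.cong[OF refl])
    fix j
    have "insert i M - {i} = M" "L - {l} - {j} = L - {j, l}"
      using assms(5) by auto
    then show "gen (i, j, M) * gen (j, l, L - {j, l}) =
        gen (entry (insert i M) i j) * gen (entry (L - {l}) j l)"
      by (simp add: entry_def)
  qed
  finally show ?thesis .
qed

text \<open>The only product contracts over the single index \<open>m\<close>, between sets whose
  sizes differ by one. Its minus sign is the reason for comparing relations through
  \<open>signed\<close>.\<close>

lemma hom_part_Q_le:
  assumes "i \<noteq> m" "i \<notin> J" "m \<notin> J"
  shows "hom_part 2 (qp i j J - (qp i j (J \<union> {m}) + qp i m J * qp m j (J \<union> {i}))) =
    (if j \<in> insert i (insert m J) then 0 else - contraction (insert i J) (insert i (insert m J)) i j)"
proof -
  have "insert i (insert m J) - insert i J = {m}" "insert i (insert m J) - {m} = insert i J"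
    "insert i J - {i} = J"
    using assms by auto
  then show ?thesis
    using assms by (auto simp: hom_part_linear hom_part_2_qp_qp contraction_def entry_def)
qed

lemma contraction_self: "contraction U U a l = 0"
  by (simp add: contraction_def)

lemma hom_part_Q_rels_subset:
  assumes "k \<ge> 1"
  shows "hom_part 2 ` (Q_rels n k :: (qgen, 'k::field) free_alg set) \<subseteq> signed (contractions n {k})"
  unfolding Q_rels_def
proof (intro image_subsetI; elim UnE CollectE exE conjE)
  fix r :: "(qgen, 'k::field) free_alg" and i j l I
  assume r: "r = qp i j I * qp j l I - qp i l I"
    and *: "i \<in> {1..n}" "j \<in> {1..n}" "l \<in> {1..n}" "I \<subseteq> {1..n}" "card I = k - 1" "i \<notin> I" "j \<notin> I"
  have fin: "finite I"
    using *(4) finite_subset by blast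
  show "hom_part 2 r \<in> signed (contractions n {k})"
  proof (cases "i = j \<or> j = l \<or> l \<in> I")
    case True
    then show ?thesis
      unfolding r hom_part_Q_triangle[OF *(6,7)] by (simp add: signed_def)
  next
    case False
    have nodes: "insert i I \<in> nodes_of n {k}" "insert j I \<in> nodes_of n {k}"
      using * fin assms by (auto simp: nodes_of_def)
    have "insert j I - insert i I = {j}"
      using * False by auto
    then have "i \<in> contracted_rows (insert i I) (insert j I)"
      using nodes by (simp add: contracted_rows_def nodes_of_def)
    moreover have "l \<in> {1..n} - insert j I"
      using * False by auto
    ultimately have "(contraction (insert i I) (insert j I) i l :: (qgen, 'k) free_alg) \<in> contractions n {k}"
      using nodes unfolding contractions_def by blast
    then show ?thesis
      unfolding r hom_part_Q_triangle[OF *(6,7)] using False by (simp add: signed_def)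
  qed
next
  fix r :: "(qgen, 'k::field) free_alg" and i l L M
  assume r: "r = (\<Sum>j\<in>L - {i, l}. qp i j M * qp j l (L - {j, l})) + qp i l (L - {i, l}) - qp i l M"
    and *: "L \<subseteq> {1..n}" "card L = k + 1" "i \<in> L" "l \<in> L" "i \<noteq> l" "M \<subseteq> {1..n}" "card M = k - 1" "i \<notin> M"
  have fin: "finite L" "finite M"
    using *(1,6) finite_subset by blast+
  have nodes: "insert i M \<in> nodes_of n {k}" "L - {l} \<in> nodes_of n {k}"
    using * fin assms by (auto simp: nodes_of_def)
  show "hom_part 2 r \<in> signed (contractions n {k})"
    unfolding r hom_part_Q_sum[OF fin(1) *(3-5) *(8)]
  proof (cases "insert i M = L - {l}")
    \<comment> \<open>The contraction range is empty here.\<close>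
    case True
    then show "(contraction (insert i M) (L - {l}) i l :: (qgen, 'k) free_alg) \<in> signed (contractions n {k})"
      by (simp add: contraction_self signed_def)
  next
    case False
    then have "i \<in> contracted_rows (insert i M) (L - {l})"
      using nodes * by (simp add: contracted_rows_def nodes_of_def)
    moreover have "l \<in> {1..n} - (L - {l})"
      using * by auto
    ultimately have "(contraction (insert i M) (L - {l}) i l :: (qgen, 'k) free_alg) \<in> contractions n {k}"
      using nodes unfolding contractions_def by blast
    then show "(contraction (insert i M) (L - {l}) i l :: (qgen, 'k) free_alg) \<in> signed (contractions n {k})"
      by (rule signedI(1))
  qed
qed

lemma Q_rels_triangleI:
  assumes "i \<in> {1..n}" "j \<in> {1..n}" "l \<in> {1..n}" "I \<subseteq> {1..n}" "card I = k - 1" "i \<notin> I" "j \<notin> I"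
  shows "qp i j I * qp j l I - qp i l I \<in> Q_rels n k"
  unfolding Q_rels_def using assms by blast

lemma Q_rels_sumI:
  assumes "L \<subseteq> {1..n}" "card L = k + 1" "i \<in> L" "l \<in> L" "i \<noteq> l" "M \<subseteq> {1..n}" "card M = k - 1" "i \<notin> M"
  shows "(\<Sum>j\<in>L - {i, l}. qp i j M * qp j l (L - {j, l})) + qp i l (L - {i, l}) - qp i l M \<in> Q_rels n k"
  unfolding Q_rels_def using assms by blast

text \<open>A row in \<open>S\<close> comes from (v') with \<open>L = insert l S\<close> and
  \<open>M = U - {a}\<close>. A row outside \<open>S\<close> is allowed only if \<open>U\<close> and
  \<open>S\<close> differ in one element, and then comes from (iii) with upper index
  \<open>U \<inter> S\<close>.\<close>

lemma contraction_in_Q_rels: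
  assumes U: "U \<subseteq> {1..n}" "card U = k" and S: "S \<subseteq> {1..n}" "card S = k" and "k \<ge> 1"
    and a: "a \<in> contracted_rows U S" and l: "l \<in> {1..n} - S"
  shows "(contraction U S a l :: (qgen, 'k::field) free_alg) \<in> hom_part 2 ` Q_rels n k"
proof -
  have fin: "finite U" "finite S"
    using U S finite_subset by blast+
  have aU: "a \<in> U"
    using a contracted_rows_subset by blast
  have insU: "insert a (U - {a}) = U" and cU: "card (U - {a}) = k - 1"
    using aU U fin by auto
  show ?thesis
  proof (cases "a \<in> S")
    case True
    let ?L = "insert l S" and ?M = "U - {a}"
    have L: "?L - {l} = S"
      using l by auto
    have props: "finite ?L" "?L \<subseteq> {1..n}" "card ?L = k + 1" "a \<in> ?L" "l \<in> ?L" "a \<noteq> l" "?M \<subseteq> {1..n}" "a \<notin> ?M"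
      using True U S l fin by auto
    have "contraction U S a l = hom_part 2 ((\<Sum>j\<in>?L - {a, l}. qp a j ?M * qp j l (?L - {j, l})) +
        qp a l (?L - {a, l}) - qp a l ?M :: (qgen, 'k) free_alg)"
      using hom_part_Q_sum[OF props(1,4,5,6,8)] unfolding insU L by (rule sym)
    then show ?thesis
      by (rule image_eqI[OF _ Q_rels_sumI[OF props(2-7) cU props(8)]])
  next
    case False
    then have one: "card (S - U) = 1"
      using a by (auto simp: contracted_rows_def split: if_splits)
    then obtain j where j: "S - U = {j}"
      by (auto simp: card_1_singleton_iff)
    \<comment> \<open>Equal sizes make \<open>U - S\<close> a singleton too, and it contains
      \<open>a\<close>.\<close>
    have "card (U - S) = card (S - U)"
      using card_Diff_subset_Int[of U S] card_Diff_subset_Int[of S U] fin U S by (simp add: Int_commute)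
    then have "card (U - S) = 1"
      using one by simp
    then obtain b where b: "U - S = {b}"
      by (auto simp: card_1_singleton_iff)
    moreover have "a \<in> U - S"
      using False aU by blast
    ultimately have "U - S = {a}"
      by simp
    then have Ua: "U - {a} = S - {j}" and jS: "j \<in> S" "j \<notin> U" "a \<noteq> j"
      using j aU by blast+
    then have insS: "insert j (U - {a}) = S"
      by blast
    have props: "a \<in> {1..n}" "j \<in> {1..n}" "l \<in> {1..n}" "U - {a} \<subseteq> {1..n}" "a \<notin> U - {a}" "j \<notin> U - {a}"
      using U S jS l aU by blast+
    have "\<not> (a = j \<or> j = l \<or> l \<in> U - {a})"
      using l jS unfolding Ua by blast
    moreover have "hom_part 2 (qp a j (U - {a}) * qp j l (U - {a}) - qp a l (U - {a}) :: (qgen, 'k) free_alg) =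
        (if a = j \<or> j = l \<or> l \<in> U - {a} then 0 else contraction U S a l)"
      using hom_part_Q_triangle[OF props(5,6)] unfolding insU insS .
    ultimately have "contraction U S a l =
        hom_part 2 (qp a j (U - {a}) * qp j l (U - {a}) - qp a l (U - {a}) :: (qgen, 'k) free_alg)"
      by presburger
    then show ?thesis
      by (rule image_eqI[OF _ Q_rels_triangleI[OF props(1-4) cU props(5,6)]])
  qed
qed

lemma signed_Q_rels:
  assumes "k \<ge> 1"
  shows "signed (hom_part 2 ` (Q_rels n k :: (qgen, 'k::field) free_alg set)) = signed (contractions n {k})"
    (is "?H = ?C")
proof
  show "?H \<subseteq> ?C"
    by (rule signed_subset[OF hom_part_Q_rels_subset[OF assms]])
  show "?C \<subseteq> ?H"
  proof (intro signed_mono, unfold contractions_def, intro subsetI; elim CollectE exE conjE)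
    fix r :: "(qgen, 'k) free_alg" and U S a l
    assume "r = contraction U S a l" "U \<in> nodes_of n {k}" "S \<in> nodes_of n {k}"
      "a \<in> contracted_rows U S" "l \<in> {1..n} - S"
    then show "r \<in> hom_part 2 ` Q_rels n k"
      using contraction_in_Q_rels[of U n k S a l] assms by (simp add: nodes_of_def)
  qed
qed

text \<open>Pairs of equal size are covered by the relations of one level, pairs of neighbouring
  sizes by the relations linking two levels; \<open>contracted_rows\<close> is empty for all other
  pairs.\<close>

lemma signed_Q_le_rels:
  "signed (hom_part 2 ` (Q_le_rels n k :: (qgen, 'k::field) free_alg set)) = signed (contractions n {2..k})"
    (is "?H = ?C")
proof
  show "?H \<subseteq> ?C"
  proof (rule signed_subset, unfold Q_le_rels_def, intro image_subsetI; elim UnE UN_E CollectE exE conjE)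
    fix r :: "(qgen, 'k::field) free_alg" and k'
    assume k': "k' \<in> {2..k}" and r: "r \<in> Q_rels n k'"
    have "hom_part 2 r \<in> signed (contractions n {k'})"
      using hom_part_Q_rels_subset[of k' n] k' r by auto
    moreover have "(contractions n {k'} :: (qgen, 'k) free_alg set) \<subseteq> contractions n {2..k}"
      using k' by (intro contractions_mono) simp
    ultimately show "hom_part 2 r \<in> signed (contractions n {2..k})"
      using signed_mono by blast
  next
    fix r :: "(qgen, 'k::field) free_alg" and i j m J
    assume r: "r = qp i j J - (qp i j (J \<union> {m}) + qp i m J * qp m j (J \<union> {i}))"
      and *: "i \<in> {1..n}" "j \<in> {1..n}" "m \<in> {1..n}" "J \<subseteq> {1..n}" "i \<noteq> m" "i \<notin> J" "m \<notin> J"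
        "1 \<le> card J" "card J \<le> k - 2"
    have fin: "finite J"
      using *(4) finite_subset by blast
    let ?U = "insert i J" and ?S = "insert i (insert m J)"
    show "hom_part 2 r \<in> signed (contractions n {2..k})"
    proof (cases "j \<in> ?S")
      case True
      then show ?thesis
        unfolding r hom_part_Q_le[OF *(5-7)] by (simp add: signed_def)
    next
      case False
      have nodes: "?U \<in> nodes_of n {2..k}" "?S \<in> nodes_of n {2..k}"
        using * fin by (auto simp: nodes_of_def)
      have "?S - ?U = {m}"
        using * by auto
      then have "i \<in> contracted_rows ?U ?S"
        by (auto simp: contracted_rows_def)
      moreover have "j \<in> {1..n} - ?S"
        using * False by auto
      ultimately have "(contraction ?U ?S i j :: (qgen, 'k) free_alg) \<in> contractions n {2..k}"
        using nodes unfolding contractions_def by blast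
      then show ?thesis
        unfolding r hom_part_Q_le[OF *(5-7)] using False by (auto simp: signed_def)
    qed
  qed
  show "?C \<subseteq> ?H"
  proof (rule signed_subset, unfold contractions_def, intro subsetI; elim CollectE exE conjE)
    fix r :: "(qgen, 'k::field) free_alg" and U S a l
    assume r: "r = contraction U S a l" and "U \<in> nodes_of n {2..k}" "S \<in> nodes_of n {2..k}"
      and a: "a \<in> contracted_rows U S" and l: "l \<in> {1..n} - S"
    then have U: "U \<subseteq> {1..n}" "card U \<in> {2..k}" and S: "S \<subseteq> {1..n}" "card S \<in> {2..k}"
      by (auto simp: nodes_of_def)
    have fin: "finite U" "finite S"
      using U S finite_subset by blast+
    show "r \<in> signed (hom_part 2 ` Q_le_rels n k)"
    proof (cases "card S = card U")
      case True
      have "r \<in> hom_part 2 ` Q_rels n (card U)"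
        unfolding r by (rule contraction_in_Q_rels) (use U S True a l in auto)
      moreover have "(Q_rels n (card U) :: (qgen, 'k) free_alg set) \<subseteq> Q_le_rels n k"
        using U(2) unfolding Q_le_rels_def by blast
      ultimately show ?thesis
        by (intro signedI(1)) blast
    next
      case False
      \<comment> \<open>Different sizes leave only the case in which \<open>S\<close> is
        \<open>U\<close> with one element added.\<close>
      then have one: "card (S - U) = 1" "U \<subseteq> S"
        using a by (auto simp: contracted_rows_def split: if_splits)
      then obtain m where m: "S - U = {m}"
        by (auto simp: card_1_singleton_iff)
      have aU: "a \<in> U"
        using a contracted_rows_subset by blast
      let ?J = "U - {a}"
      have ins: "insert a ?J = U" "insert a (insert m ?J) = S"
        using m one(2) aU by auto
      have m': "m \<in> S" "m \<notin> U" "a \<noteq> m"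
        using m aU by auto
      \<comment> \<open>Since \<open>card S\<close> is at most \<open>k\<close>, this gives the
        bound \<open>card ?J \<le> k - 2\<close> required of the linking relation.\<close>
      have cS: "card S = Suc (card U)"
        using card_Diff_subset[OF fin(1) one(2)] one(1) by simp
      have "qp a l ?J - (qp a l (?J \<union> {m}) + qp a m ?J * qp m l (?J \<union> {a})) \<in> (Q_le_rels n k :: (qgen, 'k) free_alg set)"
        unfolding Q_le_rels_def
        by (rule UnI2, rule CollectI, rule exI[of _ a], rule exI[of _ l], rule exI[of _ m], rule exI[of _ ?J])
          (use U S m' l aU cS fin in auto)
      moreover have "hom_part 2 (qp a l ?J - (qp a l (?J \<union> {m}) + qp a m ?J * qp m l (?J \<union> {a}))) =
          - (contraction U S a l :: (qgen, 'k) free_alg)"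
      proof -
        have "l \<notin> insert a (insert m ?J)"
          using l by (simp only: ins) simp
        then show ?thesis
          using hom_part_Q_le[of a m ?J l] m' by (simp only: ins if_False) simp
      qed
      ultimately show ?thesis
        unfolding r by (intro signedI(2)) (metis imageI)
    qed
  qed
qed

section \<open>Koszulness of the quasi-Pluecker algebras\<close>

lemma nonhomogeneous_koszul_Q:
  assumes "k \<ge> 1"
  shows "nonhomogeneous_koszul (Q_gens n k) (Q_rels n k :: (qgen, 'k::field) free_alg set)"
proof -
  have "koszul (Q_gens n k) (hom_part 2 ` Q_rels n k :: (qgen, 'k) free_alg set)"
    unfolding Q_gens_eq[OF assms] by (rule koszul_contractions[OF signed_Q_rels[OF assms]])
  then show ?thesis
    using Q_rels_words_le[OF assms]
    unfolding nonhomogeneous_koszul_def nonhomogeneous_quadratic_def words_le_def by blast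
qed

lemma nonhomogeneous_koszul_Q_le:
  "nonhomogeneous_koszul (Q_le_gens n k) (Q_le_rels n k :: (qgen, 'k::field) free_alg set)"
proof -
  have "koszul (Q_le_gens n k) (hom_part 2 ` Q_le_rels n k :: (qgen, 'k) free_alg set)"
    unfolding Q_le_gens_eq by (rule koszul_contractions[OF signed_Q_le_rels])
  then show ?thesis
    using Q_le_rels_words_le
    unfolding nonhomogeneous_koszul_def nonhomogeneous_quadratic_def words_le_def by blast
qed

theorem theorem12:
  fixes n k :: nat
  assumes "n \<ge> 2" and "k \<ge> 2"
  shows "nonhomogeneous_koszul (Q_gens n k) (Q_rels n k :: (qgen, 'k::field) free_alg set) \<and>
    nonhomogeneous_koszul (Q_le_gens n k) (Q_le_rels n k :: (qgen, 'k) free_alg set) \<and>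
    nonhomogeneous_koszul (Q_le_gens n n) (Q_le_rels n n :: (qgen, 'k) free_alg set)"
  using assms by (intro conjI nonhomogeneous_koszul_Q nonhomogeneous_koszul_Q_le) simp

end
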